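(* Let $\mathbf A$ be an enumerated $\mathcal L$-structure with $\mathrm{Age}(\mathbf A)\subseteq\mathcal K$, and let $1\le m<|\mathbf A|$. Suppose $f\in\mathrm{AEmb}(\mathrm{ct}^{\mathbf A}|_m,\mathrm{ct})$ and $\gamma:f'[T(m)]\to T(n)$ is an age map (for some $n$; the domain, a subset of $T(\tilde f(m-1)+1)$, carries the restriction of $\mathcal C(\tilde f(m-1)+1)$, and $T(n)$ carries $\mathcal C(n)$) with $\gamma(f'(s))\sqsupseteq f'(s)$ for each $s\in T(m)$. Then there is $g\in\mathrm{AEmb}(\mathrm{ct}^{\mathbf A}|_{m+1},\mathrm{ct})$ with $g|_{T(<m)}=f$ and $g(t)\sqsupseteq\gamma(f'(t))$ for each $t\in T(m)$. In particular, there is an aged embedding of $\mathrm{ct}^{\mathbf A}$ into $\mathrm{ct}$, i.e. $\mathrm{AEmb}(\mathrm{ct}^{\mathbf A},\mathrm{ct})\neq\emptyset$.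
   Context: Conventions. $\mathcal L=\{U_0,\dots,U_{k-1};R_0,\dots,R_{k-1}\}$ is a finite relational language, $U_i$ unary, $R_i$ binary, and all $\mathcal L$-structures $\mathbf A$ satisfy: every $R_i^{\mathbf A}$ is irreflexive; $\mathbf A=\bigsqcup_{i<k}U_i^{\mathbf A}$; $\mathbf A^2\setminus\{(a,a):a\in\mathbf A\}=\bigsqcup_{i<k}R_i^{\mathbf A}$; and there is $\mathrm{Flip}:k\to k$ with $\mathrm{Flip}^2=\mathrm{id}$, $\mathrm{Flip}(0)=0$, such that $R^{\mathbf A}(a,b)=i$ iff $R^{\mathbf A}(b,a)=\mathrm{Flip}(i)$. Here $U^{\mathbf A}(a)=i$ means $U_i^{\mathbf A}(a)$ and $R^{\mathbf A}(a,b)=i$ means $R_i^{\mathbf A}(a,b)$; $R_0$ plays the role of "no relation". $\mathcal K$ is a Fraïssé class of finite $\mathcal L$-structures with free amalgamation: any embeddings $f:\mathbf A\to\mathbf B$, $g:\mathbf A\to\mathbf C$ in $\mathcal K$ can be amalgamated by embeddings $r:\mathbf B\to\mathbf D$, $s:\mathbf C\to\mathbf D$ with $\mathbf D\in\mathcal K$, $r\circ f=s\circ g$, $\mathbf D=\mathrm{im}(r)\cup\mathrm{im}(s)$, $\mathrm{im}(r)\cap\mathrm{im}(s)=\mathrm{im}(r\circ f)$, and $R^{\mathbf D}(a,b)=0$ unless $\{a,b\}\subseteq\mathrm{im}(r)$ or $\{a,b\}\subseteq\mathrm{im}(s)$. An enumerated structure is one whose underlying set is the cardinal $|\mathbf A|\le\omega$;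 for $m\le|\mathbf A|$, $\mathbf A_m$ is the induced substructure on $m=\{0,\dots,m-1\}$. $\mathbf K$ is a Fraïssé limit of $\mathcal K$ with underlying set $\omega$ which is left dense: for every $m<\omega$ and every $\mathbf A\in\mathcal K$ with underlying set $m+1$ and $\mathbf A_m=\mathbf K_m$ there is $n\ge m$ such that the map $i\mapsto i$ ($i<m$), $m\mapsto n$ is an embedding $\mathbf A\to\mathbf K$ and $R^{\mathbf K}(r,n)=0$ for all $m\le r<n$. Write $U=U^{\mathbf K}$, $R=R^{\mathbf K}$. $\mathrm{Age}(\mathbf A)$ is the class of finite structures embeddable in $\mathbf A$. Trees. $T=k^{<\omega}$, $T(n)=k^n$, with $T(<n),T(\le n)$ as usual; $s\sqsubseteq t$ means $t$ extends $s$; $s\wedge t$ is the longest common initial segment; $s^\frown i$ appends $i<k$. Coding trees. For enumerated $\mathbf A$, $\mathrm{ct}^{\mathbf A}=(c^{\mathbf A},u^{\mathbf A})$ where $c^{\mathbf A}(j)\in T(j)$ is given by $c^{\mathbf A}(j)(i)=R^{\mathbf A}(i,j)$ for $i<j<|\mathbf A|$, and $u^{\mathbf A}(j)=U^{\mathbf A}(j)$; $\mathrm{ct}^{\mathbf A}|_m$ is the restriction to domain $m$. Write $\mathrm{ct}=(c,u)=\mathrm{ct}^{\mathbf K}$. Labeled structures. For a finite set $X$, an $X$-labeled structure is a finite $\mathcal L$-structure $\mathbf B$ with a map $\phi:\mathbf B\to X$. For enumerated $\mathbf A$, $m\le|\mathbf A|$, $m<\omega$, and a $T(m)$-labeled $(\mathbf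 B,\phi)$ with $\mathbf B\cap\omega=\emptyset$, $\mathbf B[\phi,\mathbf A]$ is the $\mathcal L$-structure on $\mathbf B\cup\mathbf A_m$ with $\mathbf B$ and $\mathbf A_m$ as induced substructures and $R(i,b)=\phi(b)(i)$ for $i<m$, $b\in\mathbf B$. If $\mathrm{Age}(\mathbf A)\subseteq\mathcal K$, $\mathcal C^{\mathbf A}(m)$ is the class of $T(m)$-labeled $(\mathbf B,\phi)$ with $\mathbf B[\phi,\mathbf A]\in\mathcal K$; $\mathcal C(m)=\mathcal C^{\mathbf K}(m)$. Given finite sets $X,Y$ with classes $\mathcal C_X,\mathcal C_Y$ of $X$- resp. $Y$-labeled structures, an age map is an injection $f:X\to Y$ such that for every $X$-labeled $(\mathbf B,\phi)$: $(\mathbf B,\phi)\in\mathcal C_X$ iff $(\mathbf B,f\circ\phi)\in\mathcal C_Y$. Unless stated otherwise, $T(m)$ and any $X\subseteq T(m)$ carry the class $\mathcal C(m)$ (restricted to $X$-labeled structures). Embeddings. Let $\mathbf A$ be enumerated with $\mathrm{Age}(\mathbf A)\subseteq\mathcal K$ and $m\le|\mathbf A|$. A map $f:T(<m)\to T$ is an embedding of $\mathrm{ct}^{\mathbf A}|_m$ into $\mathrm{ct}$ if (1) $f$ is injective; (2) there is an increasing $\tilde f:m\to\omega$ with $f[T(j)]\subseteq T(\tilde f(j))$ for $j<m$; (3) $f(s\wedge t)=f(s)\wedge f(t)$; (4) $f(s^\frown i)\sqsupseteq f(s)^\frown i$ whenever $s^\frown i\in T(<m)$; (5) $f(c^{\mathbf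 A}(j))=c(\tilde f(j))$ and $u^{\mathbf A}(j)=u(\tilde f(j))$ for $j<m$. It is an aged embedding if moreover for each $j<m$, $f|_{T(j)}:(T(j),\mathcal C^{\mathbf A}(j))\to(T(\tilde f(j)),\mathcal C(\tilde f(j)))$ is an age map. $\mathrm{AEmb}(\mathrm{ct}^{\mathbf A}|_m,\mathrm{ct})$ is the set of these, and $\mathrm{AEmb}(\mathrm{ct}^{\mathbf A},\mathrm{ct})$ the case $m=|\mathbf A|$. For $S\subseteq T$ and $f:S\to T$, $f':\{s^\frown i:s\in S,i<k\}\to T$ is defined by $f'(s^\frown i)=f(s)^\frown i$. *)

theory Defs
  imports Main "HOL-Library.Extended_Nat" "HOL-Library.Disjoint_Sets" "HOL-Library.Sublist"
begin

section \<open>Structures\<close>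

text \<open>
  The language has unary symbols \<open>U_0, ..., U_{k-1}\<close> and binary symbols \<open>R_0, ..., R_{k-1}\<close>;
  \<open>F\<close> is the map Flip.  A number \<open>i < k\<close> is an element of the set \<open>k = {0, ..., k-1}\<close>.
\<close>

definition is_flip :: "nat \<Rightarrow> (nat \<Rightarrow> nat) \<Rightarrow> bool" where
  "is_flip k F \<longleftrightarrow> 0 < k \<and> (\<forall>i<k. F i < k) \<and> (\<forall>i<k. F (F i) = i) \<and> F 0 = 0"

record 'a lstr =
  carr :: "'a set"
  urel :: "nat \<Rightarrow> 'a set"
  rrel :: "nat \<Rightarrow> ('a \<times> 'a) set"

text \<open>
  The relations with index \<open>i \<ge> k\<close>, which do not belong to the language, are required to be empty,
  so that equality of records is equality of structures.
\<close>

definition lstruct :: "nat \<Rightarrow> (nat \<Rightarrow> nat) \<Rightarrow> 'a lstr \<Rightarrow> bool" where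
  "lstruct k F A \<longleftrightarrow>
     (\<forall>i\<ge>k. urel A i = {} \<and> rrel A i = {}) \<and>
     (\<forall>i<k. irrefl (rrel A i)) \<and>
     carr A = (\<Union>i<k. urel A i) \<and> disjoint_family_on (urel A) {..<k} \<and>
     (carr A \<times> carr A) - {(a, a) | a. a \<in> carr A} = (\<Union>i<k. rrel A i) \<and>
     disjoint_family_on (rrel A) {..<k} \<and>
     (\<forall>i<k. \<forall>a b. (a, b) \<in> rrel A i \<longleftrightarrow> (b, a) \<in> rrel A (F i))"

text \<open>The values \<open>U(a)\<close> for \<open>a\<close> in the structure and \<open>R(a, b)\<close> for distinct \<open>a\<close>, \<open>b\<close> in it.\<close>

definition uval :: "'a lstr \<Rightarrow> 'a \<Rightarrow> nat" where
  "uval A a = (THE i. a \<in> urel A i)"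

definition rval :: "'a lstr \<Rightarrow> 'a \<Rightarrow> 'a \<Rightarrow> nat" where
  "rval A a b = (THE i. (a, b) \<in> rrel A i)"

definition induced :: "'a lstr \<Rightarrow> 'a set \<Rightarrow> 'a lstr" where
  "induced A S = \<lparr>carr = carr A \<inter> S, urel = (\<lambda>i. urel A i \<inter> S),
                  rrel = (\<lambda>i. rrel A i \<inter> (S \<times> S))\<rparr>"

definition embedding :: "'a lstr \<Rightarrow> 'b lstr \<Rightarrow> ('a \<Rightarrow> 'b) \<Rightarrow> bool" where
  "embedding A B f \<longleftrightarrow> f \<in> carr A \<rightarrow> carr B \<and> inj_on f (carr A) \<and>
     (\<forall>i. \<forall>a\<in>carr A. a \<in> urel A i \<longleftrightarrow> f a \<in> urel B i) \<and>
     (\<forall>i. \<forall>a\<in>carr A. \<forall>b\<in>carr A. (a, b) \<in> rrel A i \<longleftrightarrow> (f a, f b) \<in> rrel B i)"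

definition isomorphism :: "'a lstr \<Rightarrow> 'b lstr \<Rightarrow> ('a \<Rightarrow> 'b) \<Rightarrow> bool" where
  "isomorphism A B f \<longleftrightarrow> embedding A B f \<and> f ` carr A = carr B"

section \<open>Classes of finite structures\<close>

text \<open>
  A class of finite structures closed under isomorphism is represented by the set of its members
  whose underlying set is a set of natural numbers; a finite structure over another type belongs
  to the class if it is isomorphic to one of these.  Structures may be empty.
\<close>

definition in_class :: "'a lstr \<Rightarrow> nat lstr set \<Rightarrow> bool" where
  "in_class A \<K> \<longleftrightarrow> (\<exists>B\<in>\<K>. \<exists>f. isomorphism A B f)"

definition age :: "nat \<Rightarrow> (nat \<Rightarrow> nat) \<Rightarrow> 'a lstr \<Rightarrow> nat lstr set" where
  "age k F A = {B. lstruct k F B \<and> finite (carr B) \<and> (\<exists>f. embedding B A f)}"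

definition hereditary :: "nat \<Rightarrow> (nat \<Rightarrow> nat) \<Rightarrow> nat lstr set \<Rightarrow> bool" where
  "hereditary k F \<K> \<longleftrightarrow> (\<forall>B\<in>\<K>. age k F B \<subseteq> \<K>)"

definition joint_embedding :: "nat lstr set \<Rightarrow> bool" where
  "joint_embedding \<K> \<longleftrightarrow>
     (\<forall>A\<in>\<K>. \<forall>B\<in>\<K>. \<exists>C\<in>\<K>. \<exists>f g. embedding A C f \<and> embedding B C g)"

definition amalgamation :: "nat lstr set \<Rightarrow> bool" where
  "amalgamation \<K> \<longleftrightarrow>
     (\<forall>A\<in>\<K>. \<forall>B\<in>\<K>. \<forall>C\<in>\<K>. \<forall>f g. embedding A B f \<and> embedding A C g \<longrightarrow>
        (\<exists>D\<in>\<K>. \<exists>r s. embedding B D r \<and> embedding C D s \<and>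
           (\<forall>a\<in>carr A. r (f a) = s (g a))))"

definition free_amalgamation :: "nat lstr set \<Rightarrow> bool" where
  "free_amalgamation \<K> \<longleftrightarrow>
     (\<forall>A\<in>\<K>. \<forall>B\<in>\<K>. \<forall>C\<in>\<K>. \<forall>f g. embedding A B f \<and> embedding A C g \<longrightarrow>
        (\<exists>D\<in>\<K>. \<exists>r s. embedding B D r \<and> embedding C D s \<and>
           (\<forall>a\<in>carr A. r (f a) = s (g a)) \<and>
           carr D = r ` carr B \<union> s ` carr C \<and>
           r ` carr B \<inter> s ` carr C = (r \<circ> f) ` carr A \<and>
           (\<forall>a\<in>carr D. \<forall>b\<in>carr D.
              \<not> ({a, b} \<subseteq> r ` carr B \<or> {a, b} \<subseteq> s ` carr C) \<longrightarrow> rval D a b = 0)))"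

text \<open>
  Since the language is finite, there are only countably many finite structures up to isomorphism,
  so no countability clause is needed.
\<close>

definition fraisse_class :: "nat \<Rightarrow> (nat \<Rightarrow> nat) \<Rightarrow> nat lstr set \<Rightarrow> bool" where
  "fraisse_class k F \<K> \<longleftrightarrow> \<K> \<noteq> {} \<and>
     (\<forall>A\<in>\<K>. lstruct k F A \<and> finite (carr A)) \<and>
     (\<forall>A\<in>\<K>. \<forall>B :: nat lstr. lstruct k F B \<and> (\<exists>f. isomorphism A B f) \<longrightarrow> B \<in> \<K>) \<and>
     hereditary k F \<K> \<and> joint_embedding \<K> \<and> amalgamation \<K>"

definition ultrahomogeneous :: "'a lstr \<Rightarrow> bool" where
  "ultrahomogeneous K \<longleftrightarrow>
     (\<forall>S f. finite S \<and> S \<subseteq> carr K \<and> embedding (induced K S) K f \<longrightarrow>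
        (\<exists>h. isomorphism K K h \<and> (\<forall>x\<in>S. h x = f x)))"

text \<open>A Fraisse limit of \<open>\<K>\<close> with underlying set \<open>\<omega>\<close>.\<close>

definition fraisse_limit :: "nat \<Rightarrow> (nat \<Rightarrow> nat) \<Rightarrow> nat lstr set \<Rightarrow> nat lstr \<Rightarrow> bool" where
  "fraisse_limit k F \<K> K \<longleftrightarrow>
     lstruct k F K \<and> carr K = UNIV \<and> age k F K = \<K> \<and> ultrahomogeneous K"

definition left_dense :: "nat lstr set \<Rightarrow> nat lstr \<Rightarrow> bool" where
  "left_dense \<K> K \<longleftrightarrow>
     (\<forall>m. \<forall>A\<in>\<K>. carr A = {..<Suc m} \<and> induced A {..<m} = induced K {..<m} \<longrightarrow>
        (\<exists>n\<ge>m. embedding A K (\<lambda>i. if i < m then i else n) \<and>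
               (\<forall>r. m \<le> r \<and> r < n \<longrightarrow> rval K r n = 0)))"

section \<open>Enumerated structures and coding trees\<close>

definition esize :: "'a lstr \<Rightarrow> enat" where
  "esize A = (if finite (carr A) then enat (card (carr A)) else \<infinity>)"

definition enumerated :: "nat \<Rightarrow> (nat \<Rightarrow> nat) \<Rightarrow> nat lstr \<Rightarrow> bool" where
  "enumerated k F A \<longleftrightarrow> lstruct k F A \<and> carr A = {i. enat i < esize A}"

definition T :: "nat \<Rightarrow> nat list set" where
  "T k = {s. set s \<subseteq> {..<k}}"

definition Tlev :: "nat \<Rightarrow> nat \<Rightarrow> nat list set" where
  "Tlev k m = {s \<in> T k. length s = m}"

definition Tbelow :: "nat \<Rightarrow> enat \<Rightarrow> nat list set" where
  "Tbelow k M = {s \<in> T k. enat (length s) < M}"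

definition ctc :: "nat lstr \<Rightarrow> nat \<Rightarrow> nat list" where
  "ctc A j = map (\<lambda>i. rval A i j) [0..<j]"

definition ctu :: "nat lstr \<Rightarrow> nat \<Rightarrow> nat" where
  "ctu A j = uval A j"

section \<open>Labeled structures and age maps\<close>

text \<open>
  Labeled structures are taken with underlying set a finite set of natural numbers; the values of
  the labeling outside the underlying set are irrelevant.
\<close>

type_synonym 'x labeled = "nat lstr \<times> (nat \<Rightarrow> 'x)"

definition labeled_strs :: "nat \<Rightarrow> (nat \<Rightarrow> nat) \<Rightarrow> 'x set \<Rightarrow> 'x labeled set" where
  "labeled_strs k F X =
     {(B, \<phi>). lstruct k F B \<and> finite (carr B) \<and> \<phi> \<in> carr B \<rightarrow> X}"

text \<open>
  The structure \<open>B[\<phi>, A]\<close> for a labeling \<open>\<phi>\<close> of \<open>B\<close> in \<open>T(m)\<close>.  The disjoint sum realizes the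
  requirement that \<open>B\<close> is disjoint from \<open>\<omega>\<close>: \<open>Inl\<close> is the copy of \<open>B\<close> and \<open>Inr\<close> that of \<open>A_m\<close>.
  The relation from \<open>b\<close> to \<open>i\<close> is determined by \<open>R(i, b) = \<phi>(b)(i)\<close> and Flip.
\<close>

definition bracket ::
  "(nat \<Rightarrow> nat) \<Rightarrow> nat lstr \<Rightarrow> (nat \<Rightarrow> nat list) \<Rightarrow> nat lstr \<Rightarrow> nat \<Rightarrow> (nat + nat) lstr" where
  "bracket F B \<phi> A m = (let Am = induced A {..<m} in
     \<lparr>carr = Inl ` carr B \<union> Inr ` carr Am,
      urel = (\<lambda>j. Inl ` urel B j \<union> Inr ` urel Am j),
      rrel = (\<lambda>j. map_prod Inl Inl ` rrel B j \<union> map_prod Inr Inr ` rrel Am j \<union>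
                  {(Inr i, Inl b) | i b. i < m \<and> b \<in> carr B \<and> \<phi> b ! i = j} \<union>
                  {(Inl b, Inr i) | i b. i < m \<and> b \<in> carr B \<and> F (\<phi> b ! i) = j})\<rparr>)"

text \<open>The class \<open>\<C>^A(m)\<close>.\<close>

definition Cls ::
  "nat \<Rightarrow> (nat \<Rightarrow> nat) \<Rightarrow> nat lstr set \<Rightarrow> nat lstr \<Rightarrow> nat \<Rightarrow> nat list labeled set" where
  "Cls k F \<K> A m =
     {(B, \<phi>) \<in> labeled_strs k F (Tlev k m). in_class (bracket F B \<phi> A m) \<K>}"

definition restr_cls :: "'x set \<Rightarrow> 'x labeled set \<Rightarrow> 'x labeled set" where
  "restr_cls X C = {(B, \<phi>) \<in> C. \<phi> \<in> carr B \<rightarrow> X}"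

definition age_map ::
  "nat \<Rightarrow> (nat \<Rightarrow> nat) \<Rightarrow> 'x set \<Rightarrow> 'x labeled set \<Rightarrow> 'y set \<Rightarrow> 'y labeled set
     \<Rightarrow> ('x \<Rightarrow> 'y) \<Rightarrow> bool" where
  "age_map k F X CX Y CY f \<longleftrightarrow> f \<in> X \<rightarrow> Y \<and> inj_on f X \<and>
     (\<forall>(B, \<phi>) \<in> labeled_strs k F X. (B, \<phi>) \<in> CX \<longleftrightarrow> (B, f \<circ> \<phi>) \<in> CY)"

section \<open>Aged embeddings\<close>

text \<open>
  \<open>h\<close> is the level function (written \<open>f\<close> with a tilde) of the map \<open>f\<close> on \<open>T(<M)\<close>, where
  \<open>M \<le> \<omega>\<close>.  As levels of \<open>T\<close> are nonempty and disjoint, it is determined by \<open>f\<close> on the \<open>j < M\<close>.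
\<close>

definition level_fun :: "nat \<Rightarrow> enat \<Rightarrow> (nat list \<Rightarrow> nat list) \<Rightarrow> (nat \<Rightarrow> nat) \<Rightarrow> bool" where
  "level_fun k M f h \<longleftrightarrow> strict_mono_on {j. enat j < M} h \<and>
     (\<forall>j. enat j < M \<longrightarrow> f ` Tlev k j \<subseteq> Tlev k (h j))"

definition ct_embedding ::
  "nat \<Rightarrow> nat lstr \<Rightarrow> enat \<Rightarrow> nat lstr \<Rightarrow> (nat list \<Rightarrow> nat list) \<Rightarrow> (nat \<Rightarrow> nat) \<Rightarrow> bool" where
  "ct_embedding k A M K f h \<longleftrightarrow>
     f \<in> Tbelow k M \<rightarrow> T k \<and> inj_on f (Tbelow k M) \<and>
     level_fun k M f h \<and>
     (\<forall>s\<in>Tbelow k M. \<forall>t\<in>Tbelow k M.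
        f (longest_common_prefix s t) = longest_common_prefix (f s) (f t)) \<and>
     (\<forall>s i. s @ [i] \<in> Tbelow k M \<longrightarrow> prefix (f s @ [i]) (f (s @ [i]))) \<and>
     (\<forall>j. enat j < M \<longrightarrow> f (ctc A j) = ctc K (h j) \<and> ctu A j = ctu K (h j))"

text \<open>
  \<open>AEmb(ct^A|_M, ct^K)\<close> for \<open>M \<le> |A|\<close>.  Its members are total functions of which only the
  restriction to \<open>T(<M)\<close> matters.
\<close>

definition AEmb ::
  "nat \<Rightarrow> (nat \<Rightarrow> nat) \<Rightarrow> nat lstr set \<Rightarrow> nat lstr \<Rightarrow> enat \<Rightarrow> nat lstr
     \<Rightarrow> (nat list \<Rightarrow> nat list) set" where
  "AEmb k F \<K> A M K = {f. \<exists>h. ct_embedding k A M K f h \<and>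
     (\<forall>j. enat j < M \<longrightarrow>
        age_map k F (Tlev k j) (Cls k F \<K> A j) (Tlev k (h j)) (Cls k F \<K> K (h j)) f)}"

text \<open>The map \<open>f'\<close> with \<open>f'(s i) = f(s) i\<close>, on nonempty sequences.\<close>

definition succ_map :: "(nat list \<Rightarrow> nat list) \<Rightarrow> nat list \<Rightarrow> nat list" where
  "succ_map f t = f (butlast t) @ [last t]"

end

theory Submission
  imports Defs
begin

text \<open>
  Suppose \<open>f\<close> is defined on \<open>T(<m)\<close>.  Moving the vertex \<open>m - 1\<close> of \<open>A\<close> from the structure part of
  \<open>B[\<phi>, A_m]\<close> to the labeled part turns the age map property of \<open>f\<close> on \<open>T(m - 1)\<close> into that of \<open>f'\<close> on
  \<open>T(m)\<close>, so \<open>\<gamma> \<circ> f'\<close> is an age map into \<open>T(n)\<close>.  Since \<open>A_{m+1}\<close> is in \<open>\<K>\<close>, a point labeled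
  \<open>\<gamma>(f'(c(m)))\<close> can be added to \<open>K_n\<close>, and left density realizes it by a vertex \<open>n'\<close> of \<open>K\<close> whose
  coding node is that label followed by zeros.  Adding these zeros to all labels is an age map from
  \<open>T(n)\<close> to \<open>T(n')\<close> by free amalgamation.
\<close>

section \<open>Structures given by their values\<close>

text \<open>An age map is tested on labeled structures of every finite size, so it may be applied to
  \<open>B\<close> enlarged by a vertex. The enlargements over \<open>A\<close> and over
  \<open>K\<close> match because \<open>f\<close> sends coding nodes to coding nodes with the same
  unary predicate; this is where aged embeddings must respect the coding. The obstacle is that left
  density gives no control over how far \<open>n'\<close> lies beyond \<open>n\<close>. All other
  nodes of the level have to be lifted to height \<open>n'\<close> as well, without changing which
  labeled structures are allowed. Left density forces the lift of the coding node to consist of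
  zeros, and zeros are exactly the values that a free amalgam gives to new pairs, so one uniform
  lift serves all nodes. The second simplification is to express aged embeddings one level at a
  time: the extension then alters a single level, and for infinite \<open>A\<close> the levels are
  collected from a coherent sequence of finite stages. Structures are compared throughout by the
  values of their relations, not relation by relation.\<close>

definition mkstr :: "'a set \<Rightarrow> ('a \<Rightarrow> nat) \<Rightarrow> ('a \<Rightarrow> 'a \<Rightarrow> nat) \<Rightarrow> 'a lstr" where
  "mkstr C u r = \<lparr>carr = C, urel = (\<lambda>i. {a \<in> C. u a = i}),
                  rrel = (\<lambda>i. {(a, b). a \<in> C \<and> b \<in> C \<and> a \<noteq> b \<and> r a b = i})\<rparr>"

lemma carr_mkstr [simp]: "carr (mkstr C u r) = C"
  by (simp add: mkstr_def)

lemma uval_mkstr [simp]: "a \<in> C \<Longrightarrow> uval (mkstr C u r) a = u a"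
  by (simp add: mkstr_def uval_def)

lemma rval_mkstr [simp]: "a \<in> C \<Longrightarrow> b \<in> C \<Longrightarrow> a \<noteq> b \<Longrightarrow> rval (mkstr C u r) a b = r a b"
  by (simp add: mkstr_def rval_def)

text \<open>Only off-diagonal values of \<open>r\<close> enter, and relations with index
  \<open>\<ge> k\<close> come out empty because all values lie below \<open>k\<close>. The symmetry
  clause is an equivalence; its converse half uses that \<open>F\<close> is an involution below
  \<open>k\<close>.\<close>

lemma lstruct_mkstr:
  assumes "is_flip k F" and "\<And>a. a \<in> C \<Longrightarrow> u a < k"
    and "\<And>a b. a \<in> C \<Longrightarrow> b \<in> C \<Longrightarrow> a \<noteq> b \<Longrightarrow> r a b < k"
    and "\<And>a b. a \<in> C \<Longrightarrow> b \<in> C \<Longrightarrow> a \<noteq> b \<Longrightarrow> r b a = F (r a b)"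
  shows "lstruct k F (mkstr C u r)"
proof -
  have F: "F i < k" "F (F i) = i" if "i < k" for i
    using assms(1) that by (auto simp: is_flip_def)
  have "r a b = i \<longleftrightarrow> r b a = F i" if "i < k" "a \<in> C" "b \<in> C" "a \<noteq> b" for a b i
    using that F assms(3,4) by metis
  then have sym: "(a, b) \<in> rrel (mkstr C u r) i \<longleftrightarrow> (b, a) \<in> rrel (mkstr C u r) (F i)"
    if "i < k" for a b i
    using that by (auto simp: mkstr_def)
  have mem: "a \<in> urel (mkstr C u r) i \<longleftrightarrow> a \<in> C \<and> u a = i"
    "(a, b) \<in> rrel (mkstr C u r) i \<longleftrightarrow> a \<in> C \<and> b \<in> C \<and> a \<noteq> b \<and> r a b = i" for a b i
    by (auto simp: mkstr_def)
  have un: "carr (mkstr C u r) = (\<Union>i<k. urel (mkstr C u r) i)"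
    using assms(2) by (auto simp: mem)
  have un2: "carr (mkstr C u r) \<times> carr (mkstr C u r) - {(a, a) | a. a \<in> carr (mkstr C u r)} =
      (\<Union>i<k. rrel (mkstr C u r) i)"
    using assms(3) by (simp add: set_eq_iff mem) blast
  have "a \<notin> urel (mkstr C u r) i" if "i \<ge> k" for a i
    using assms(2)[of a] that by (auto simp: mem)
  then have emp: "urel (mkstr C u r) i = {}" if "i \<ge> k" for i
    using that by blast
  have "p \<notin> rrel (mkstr C u r) i" if "i \<ge> k" for p i
    using assms(3)[of "fst p" "snd p"] that by (cases p) (auto simp: mem)
  then have emp2: "rrel (mkstr C u r) i = {}" if "i \<ge> k" for i
    using that by blast
  have disj: "disjoint_family_on (urel (mkstr C u r)) {..<k}"
    "disjoint_family_on (rrel (mkstr C u r)) {..<k}" "irrefl (rrel (mkstr C u r) i)" for i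
    by (auto simp: mem disjoint_family_on_def irrefl_def)
  show ?thesis
    unfolding lstruct_def by (intro conjI allI impI sym un un2 emp emp2 disj)
qed

section \<open>Values of the unary and binary relations\<close>

lemma lstructD:
  assumes "lstruct k F A"
  shows "i \<ge> k \<Longrightarrow> urel A i = {}" "i \<ge> k \<Longrightarrow> rrel A i = {}"
    "carr A = (\<Union>i<k. urel A i)" "disjoint_family_on (urel A) {..<k}"
    "(carr A \<times> carr A) - {(a, a) | a. a \<in> carr A} = (\<Union>i<k. rrel A i)"
    "disjoint_family_on (rrel A) {..<k}"
    "i < k \<Longrightarrow> (a, b) \<in> rrel A i \<longleftrightarrow> (b, a) \<in> rrel A (F i)"
  using assms unfolding lstruct_def by (elim conjE; simp)+

lemma lstruct_urelD:
  assumes "lstruct k F A" "a \<in> urel A i"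
  shows "i < k \<and> a \<in> carr A"
proof -
  have "i < k" using assms(2) lstructD(1)[OF assms(1), of i] by (cases "i < k") auto
  then show ?thesis using assms(2) lstructD(3)[OF assms(1)] by blast
qed

lemma lstruct_rrelD:
  assumes "lstruct k F A" "(a, b) \<in> rrel A i"
  shows "i < k \<and> a \<in> carr A \<and> b \<in> carr A \<and> a \<noteq> b"
proof -
  have i: "i < k" using assms(2) lstructD(2)[OF assms(1), of i] by (cases "i < k") auto
  then have "(a, b) \<in> (\<Union>i<k. rrel A i)" using assms(2) by auto
  then show ?thesis using i unfolding lstructD(5)[OF assms(1), symmetric] by auto
qed

lemma lstruct_uval:
  assumes "lstruct k F A" "a \<in> carr A"
  shows "uval A a < k" "a \<in> urel A i \<longleftrightarrow> uval A a = i"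
proof -
  have "a \<in> (\<Union>i<k. urel A i)" using assms(2) unfolding lstructD(3)[OF assms(1)] .
  then obtain j where j: "j < k" "a \<in> urel A j" by auto
  have *: "i = j" if "a \<in> urel A i" for i
    using that j lstruct_urelD[OF assms(1) that] disjoint_family_onD[OF lstructD(4)[OF assms(1)], of i j]
    by auto
  have "uval A a = j" unfolding uval_def by (rule the_equality) (rule j(2), rule *)
  then show "uval A a < k" "a \<in> urel A i \<longleftrightarrow> uval A a = i" using j *[of i] by auto
qed

lemma lstruct_rval:
  assumes "lstruct k F A" "a \<in> carr A" "b \<in> carr A" "a \<noteq> b"
  shows "rval A a b < k" "(a, b) \<in> rrel A i \<longleftrightarrow> rval A a b = i"
proof -
  have "(a, b) \<in> (\<Union>i<k. rrel A i)"
    using assms(2-4) unfolding lstructD(5)[OF assms(1), symmetric] by auto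
  then obtain j where j: "j < k" "(a, b) \<in> rrel A j" by auto
  have *: "i = j" if "(a, b) \<in> rrel A i" for i
    using that j lstruct_rrelD[OF assms(1) that] disjoint_family_onD[OF lstructD(6)[OF assms(1)], of i j]
    by auto
  have "rval A a b = j" unfolding rval_def by (rule the_equality) (rule j(2), rule *)
  then show "rval A a b < k" "(a, b) \<in> rrel A i \<longleftrightarrow> rval A a b = i" using j *[of i] by auto
qed

lemma lstruct_urel_iff: "lstruct k F A \<Longrightarrow> a \<in> urel A i \<longleftrightarrow> a \<in> carr A \<and> uval A a = i"
  using lstruct_urelD[of k F A a i] lstruct_uval(2)[of k F A a i] by blast

lemma lstruct_rrel_iff:
  "lstruct k F A \<Longrightarrow>
    (a, b) \<in> rrel A i \<longleftrightarrow> a \<in> carr A \<and> b \<in> carr A \<and> a \<noteq> b \<and> rval A a b = i"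
  using lstruct_rrelD[of k F A a b i] lstruct_rval(2)[of k F A a b i] by blast

lemma rval_flip:
  assumes "lstruct k F A" "a \<in> carr A" "b \<in> carr A" "a \<noteq> b"
  shows "rval A b a = F (rval A a b)"
proof -
  have "(a, b) \<in> rrel A (rval A a b)" using lstruct_rval(2)[OF assms] by simp
  then have "(b, a) \<in> rrel A (F (rval A a b))"
    using lstructD(7)[OF assms(1) lstruct_rval(1)[OF assms]] by blast
  then show ?thesis using lstruct_rval(2)[of k F A b a] assms by auto
qed

text \<open>In a structure every point has exactly one unary index and every off-diagonal pair
  exactly one binary index, so agreement of all relations amounts to agreement of these values.
  Nearly all embeddings below are checked in this form.\<close>

lemma embedding_iff_vals:
  assumes X: "lstruct k F X" and Y: "lstruct k F Y"
  shows "embedding X Y f \<longleftrightarrow> f \<in> carr X \<rightarrow> carr Y \<and> inj_on f (carr X) \<and>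
    (\<forall>a\<in>carr X. uval Y (f a) = uval X a) \<and>
    (\<forall>a\<in>carr X. \<forall>b\<in>carr X. a \<noteq> b \<longrightarrow> rval Y (f a) (f b) = rval X a b)"
    (is "?L \<longleftrightarrow> ?R")
proof
  assume L: ?L
  then have f: "f \<in> carr X \<rightarrow> carr Y" and inj: "inj_on f (carr X)" by (auto simp: embedding_def)
  have "uval Y (f a) = uval X a" if "a \<in> carr X" for a
    using L that f lstruct_uval(2)[OF X, of a] lstruct_uval(2)[OF Y, of "f a"]
    unfolding embedding_def by blast
  moreover have "rval Y (f a) (f b) = rval X a b"
    if "a \<in> carr X" "b \<in> carr X" "a \<noteq> b" for a b
  proof -
    have "f a \<in> carr Y" "f b \<in> carr Y" "f a \<noteq> f b" using that f inj by (auto dest: inj_onD)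
    then show ?thesis
      using L that lstruct_rval(2)[OF X, of a b] lstruct_rval(2)[OF Y, of "f a" "f b"]
      unfolding embedding_def by blast
  qed
  ultimately show ?R using f inj by auto
next
  assume R: ?R
  have "(a, b) \<in> rrel X i \<longleftrightarrow> (f a, f b) \<in> rrel Y i" if "a \<in> carr X" "b \<in> carr X" for a b i
  proof (cases "a = b")
    case True
    then show ?thesis using lstruct_rrelD[OF X] lstruct_rrelD[OF Y] by blast
  next
    case False
    then have "f a \<in> carr Y" "f b \<in> carr Y" "f a \<noteq> f b" using that R by (auto dest: inj_onD)
    then show ?thesis
      using R that False lstruct_rval(2)[OF X, of a b] lstruct_rval(2)[OF Y, of "f a" "f b"]
      by simp
  qed
  moreover have "a \<in> urel X i \<longleftrightarrow> f a \<in> urel Y i" if "a \<in> carr X" for a i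
    using R that lstruct_uval(2)[OF X, of a] lstruct_uval(2)[OF Y, of "f a"] by auto
  ultimately show ?L using R by (simp add: embedding_def)
qed

section \<open>Composition and inversion of embeddings, induced substructures\<close>

lemma embedding_comp: "embedding X Y f \<Longrightarrow> embedding Y Z g \<Longrightarrow> embedding X Z (g \<circ> f)"
  unfolding embedding_def
  by (intro conjI) (auto simp: Pi_iff intro!: comp_inj_on inj_on_subset[where B = "f ` carr X"])

lemma isomorphism_comp:
  "isomorphism X Y f \<Longrightarrow> isomorphism Y Z g \<Longrightarrow> isomorphism X Z (g \<circ> f)"
  unfolding isomorphism_def by (metis embedding_comp image_comp)

lemma isomorphism_inv:
  assumes "isomorphism X Y f"
  shows "isomorphism Y X (inv_into (carr X) f)"
proof -
  have f: "embedding X Y f" "f ` carr X = carr Y" using assms by (auto simp: isomorphism_def)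
  then have b: "bij_betw f (carr X) (carr Y)" by (auto simp: embedding_def bij_betw_def)
  have "bij_betw (inv_into (carr X) f) (carr Y) (carr X)" by (rule bij_betw_inv_into[OF b])
  moreover have "f (inv_into (carr X) f y) = y" "inv_into (carr X) f y \<in> carr X"
    if "y \<in> carr Y" for y
    using that f(2) by (auto simp: f_inv_into_f inv_into_into)
  ultimately show ?thesis
    using f(1) unfolding isomorphism_def embedding_def by (auto simp: bij_betw_def)
qed

lemma carr_induced [simp]: "carr (induced A S) = carr A \<inter> S"
  by (simp add: induced_def)

lemma uval_induced [simp]: "a \<in> S \<Longrightarrow> uval (induced A S) a = uval A a"
  by (simp add: induced_def uval_def)

lemma rval_induced [simp]: "a \<in> S \<Longrightarrow> b \<in> S \<Longrightarrow> rval (induced A S) a b = rval A a b"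
  by (simp add: induced_def rval_def)

lemma induced_eq_mkstr:
  assumes "lstruct k F A"
  shows "induced A S = mkstr (carr A \<inter> S) (uval A) (rval A)"
  by (rule lstr.equality)
    (auto simp: mkstr_def induced_def fun_eq_iff lstruct_urel_iff[OF assms]
      lstruct_rrel_iff[OF assms])

lemma lstruct_induced: "is_flip k F \<Longrightarrow> lstruct k F A \<Longrightarrow> lstruct k F (induced A S)"
  by (subst induced_eq_mkstr, assumption, rule lstruct_mkstr)
    (auto simp: lstruct_uval lstruct_rval intro: rval_flip)

lemma embedding_induced: "embedding (induced A S) A id"
  by (auto simp: embedding_def induced_def)

lemma ctc_in_Tlev: "lstruct k F A \<Longrightarrow> {..q} \<subseteq> carr A \<Longrightarrow> ctc A q \<in> Tlev k q"
  by (auto simp: Tlev_def T_def ctc_def subset_iff intro!: lstruct_rval)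

lemma Tlev_Suc: "t \<in> Tlev k (Suc q) \<longleftrightarrow> t \<noteq> [] \<and> butlast t \<in> Tlev k q \<and> last t < k"
  by (cases t rule: rev_cases) (auto simp: Tlev_def T_def)

lemma pad_in_Tlev:
  "0 < k \<Longrightarrow> t \<in> Tlev k n \<Longrightarrow> n \<le> n' \<Longrightarrow> t @ replicate (n' - n) 0 \<in> Tlev k n'"
  by (auto simp: Tlev_def T_def)

section \<open>Labeled structures\<close>

definition brval ::
  "(nat \<Rightarrow> nat) \<Rightarrow> nat lstr \<Rightarrow> (nat \<Rightarrow> nat list) \<Rightarrow> nat lstr \<Rightarrow> nat + nat \<Rightarrow> nat + nat \<Rightarrow> nat" where
  "brval F B \<phi> A x y = (case x of
     Inl a \<Rightarrow> (case y of Inl b \<Rightarrow> rval B a b | Inr i \<Rightarrow> F (\<phi> a ! i))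
   | Inr i \<Rightarrow> (case y of Inl b \<Rightarrow> \<phi> b ! i | Inr j \<Rightarrow> rval A i j))"

lemma rrel_bracket:
  "(Inl a, Inl b) \<in> rrel (bracket F B \<phi> A m) j \<longleftrightarrow> (a, b) \<in> rrel B j"
  "(Inr i, Inr i') \<in> rrel (bracket F B \<phi> A m) j \<longleftrightarrow> (i, i') \<in> rrel A j \<and> i < m \<and> i' < m"
  "(Inr i, Inl b) \<in> rrel (bracket F B \<phi> A m) j \<longleftrightarrow> i < m \<and> b \<in> carr B \<and> \<phi> b ! i = j"
  "(Inl b, Inr i) \<in> rrel (bracket F B \<phi> A m) j \<longleftrightarrow> i < m \<and> b \<in> carr B \<and> F (\<phi> b ! i) = j"
  by (force simp: bracket_def Let_def induced_def)+

text \<open>The inclusion \<open>{..<m} \<subseteq> carr A\<close> matters: the clauses for labels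
  range over all \<open>i < m\<close>, and would otherwise relate points outside the
  carrier.\<close>

lemma bracket_eq_mkstr:
  assumes "lstruct k F B" "lstruct k F A" "{..<m} \<subseteq> carr A"
  shows "bracket F B \<phi> A m =
    mkstr (Inl ` carr B \<union> Inr ` {..<m}) (case_sum (uval B) (uval A)) (brval F B \<phi> A)"
proof (rule lstr.equality)
  show "carr (bracket F B \<phi> A m) = carr (mkstr (Inl ` carr B \<union> Inr ` {..<m})
      (case_sum (uval B) (uval A)) (brval F B \<phi> A))"
    using assms(3) by (auto simp: bracket_def Let_def)
  show "urel (bracket F B \<phi> A m) = urel (mkstr (Inl ` carr B \<union> Inr ` {..<m})
      (case_sum (uval B) (uval A)) (brval F B \<phi> A))"
    using assms(3)
    by (auto simp: bracket_def mkstr_def induced_def Let_def fun_eq_iff subset_iff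
        lstruct_urel_iff[OF assms(1)] lstruct_urel_iff[OF assms(2)])
  show "rrel (bracket F B \<phi> A m) = rrel (mkstr (Inl ` carr B \<union> Inr ` {..<m})
      (case_sum (uval B) (uval A)) (brval F B \<phi> A))"
  proof (intro ext set_eqI)
    fix j and p :: "(nat + nat) \<times> (nat + nat)"
    have lt: "i \<in> carr A" if "i < m" for i using assms(3) that by auto
    obtain x y where p: "p = (x, y)" by (cases p)
    show "p \<in> rrel (bracket F B \<phi> A m) j \<longleftrightarrow>
      p \<in> rrel (mkstr (Inl ` carr B \<union> Inr ` {..<m}) (case_sum (uval B) (uval A)) (brval F B \<phi> A)) j"
      unfolding p
      by (cases x; cases y)
        (auto simp: rrel_bracket mkstr_def brval_def lt lstruct_rrel_iff[OF assms(1)]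
          lstruct_rrel_iff[OF assms(2)])
  qed
qed (simp add: bracket_def mkstr_def Let_def)

context
  fixes k F m \<phi> and A B :: "nat lstr"
  assumes F: "is_flip k F" and B: "lstruct k F B" and A: "lstruct k F A"
    and m: "{..<m} \<subseteq> carr A" and \<phi>: "\<phi> \<in> carr B \<rightarrow> Tlev k m"
begin

lemma carr_bracket: "carr (bracket F B \<phi> A m) = Inl ` carr B \<union> Inr ` {..<m}"
  by (simp add: bracket_eq_mkstr[OF B A m])

lemma uval_bracket:
  "x \<in> carr (bracket F B \<phi> A m) \<Longrightarrow> uval (bracket F B \<phi> A m) x = case_sum (uval B) (uval A) x"
  by (simp add: bracket_eq_mkstr[OF B A m])

lemma rval_bracket:
  "x \<in> carr (bracket F B \<phi> A m) \<Longrightarrow> y \<in> carr (bracket F B \<phi> A m) \<Longrightarrow> x \<noteq> y \<Longrightarrow>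
    rval (bracket F B \<phi> A m) x y = brval F B \<phi> A x y"
  by (simp add: bracket_eq_mkstr[OF B A m])

lemma lstruct_bracket: "lstruct k F (bracket F B \<phi> A m)"
  unfolding bracket_eq_mkstr[OF B A m]
proof (rule lstruct_mkstr[OF F])
  have m': "i \<in> carr A" if "i < m" for i using m that by auto
  have lab: "\<phi> b ! i < k" if "b \<in> carr B" "i < m" for b i
    using \<phi> that by (auto simp: Tlev_def T_def Pi_iff subset_iff)
  have F': "F i < k" "F (F i) = i" if "i < k" for i using F that by (auto simp: is_flip_def)
  fix x y :: "nat + nat"
  let ?C = "Inl ` carr B \<union> Inr ` {..<m}"
  show "case_sum (uval B) (uval A) x < k" if "x \<in> ?C"
    using that m' lstruct_uval(1)[OF A] lstruct_uval(1)[OF B] by auto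
  show "brval F B \<phi> A x y < k" if "x \<in> ?C" "y \<in> ?C" "x \<noteq> y"
    using that m' lab F' lstruct_rval(1)[OF A] lstruct_rval(1)[OF B]
    by (cases x; cases y) (auto simp: brval_def)
  show "brval F B \<phi> A y x = F (brval F B \<phi> A x y)" if "x \<in> ?C" "y \<in> ?C" "x \<noteq> y"
    using that m' lab F'
    by (cases x; cases y) (auto simp: brval_def intro: rval_flip[OF A] rval_flip[OF B])
qed

end

text \<open>Here \<open>r b\<close> is the value from the new point \<open>p\<close> to
  \<open>b\<close>, the same direction in which a label stores the value from a vertex to
  \<open>b\<close>. Hence the last entry of a label can be used as \<open>r\<close>
  directly.\<close>

definition one_point_ext ::
  "(nat \<Rightarrow> nat) \<Rightarrow> nat lstr \<Rightarrow> nat \<Rightarrow> nat \<Rightarrow> (nat \<Rightarrow> nat) \<Rightarrow> nat lstr" where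
  "one_point_ext F B p v r = mkstr (insert p (carr B)) ((uval B)(p := v))
     (\<lambda>a b. if a = p then r b else if b = p then F (r a) else rval B a b)"

lemma lstruct_one_point_ext:
  assumes F: "is_flip k F" and B: "lstruct k F B" and "p \<notin> carr B" "v < k"
    and "\<And>b. b \<in> carr B \<Longrightarrow> r b < k"
  shows "lstruct k F (one_point_ext F B p v r)"
  unfolding one_point_ext_def
proof (rule lstruct_mkstr[OF F])
  have F': "F i < k" "F (F i) = i" if "i < k" for i using F that by (auto simp: is_flip_def)
  fix a b
  show "((uval B)(p := v)) a < k" if "a \<in> insert p (carr B)"
    using that assms lstruct_uval(1)[OF B] by auto
  let ?R = "\<lambda>a b. if a = p then r b else if b = p then F (r a) else rval B a b"
  assume ab: "a \<in> insert p (carr B)" "b \<in> insert p (carr B)" "a \<noteq> b"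
  show "?R a b < k"
    using ab assms(5) F' lstruct_rval(1)[OF B] by auto
  show "?R b a = F (?R a b)"
    using ab assms(3,5) F' by (auto intro: rval_flip[OF B])
qed

text \<open>The vertex \<open>q\<close> of \<open>A\<close> is moved from the structure to the labeled part, as the point \<open>p\<close>.\<close>

lemma bracket_Suc_isomorphism:
  assumes F: "is_flip k F" and B: "lstruct k F B" and p: "p \<notin> carr B"
    and A: "lstruct k F A" and q: "{..<Suc q} \<subseteq> carr A" and \<phi>: "\<phi> \<in> carr B \<rightarrow> Tlev k (Suc q)"
  defines "B' \<equiv> one_point_ext F B p (uval A q) (last \<circ> \<phi>)"
    and "\<phi>' \<equiv> \<lambda>b. if b = p then ctc A q else butlast (\<phi> b)"
  shows "lstruct k F B'" "\<phi>' \<in> carr B' \<rightarrow> Tlev k q"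
    "isomorphism (bracket F B \<phi> A (Suc q)) (bracket F B' \<phi>' A q)
       (case_sum Inl (\<lambda>i. if i = q then Inl p else Inr i))"
proof -
  have lab: "length (\<phi> b) = Suc q" "set (\<phi> b) \<subseteq> {..<k}" "\<phi> b \<noteq> []" if "b \<in> carr B" for b
    using \<phi> that by (force simp: Tlev_def T_def)+
  have last: "last (\<phi> b) < k" if "b \<in> carr B" for b
    using lab[OF that] last_in_set by blast
  show B': "lstruct k F B'"
    unfolding B'_def using q last
    by (intro lstruct_one_point_ext[OF F B p] lstruct_uval[OF A]) auto
  have q': "{..q} \<subseteq> carr A" using q by auto
  have cB': "carr B' = insert p (carr B)" by (simp add: B'_def one_point_ext_def)
  show \<phi>': "\<phi>' \<in> carr B' \<rightarrow> Tlev k q"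
    using ctc_in_Tlev[OF A q'] \<phi> unfolding cB' \<phi>'_def by (auto simp: Tlev_Suc Pi_iff)
  have q0: "{..<q} \<subseteq> carr A" using q by auto
  note c = carr_bracket[OF F B A q \<phi>] carr_bracket[OF F B' A q0 \<phi>']
  have "embedding (bracket F B \<phi> A (Suc q)) (bracket F B' \<phi>' A q)
       (case_sum Inl (\<lambda>i. if i = q then Inl p else Inr i))"
    unfolding embedding_iff_vals[OF lstruct_bracket[OF F B A q \<phi>] lstruct_bracket[OF F B' A q0 \<phi>']]
  proof (intro conjI ballI impI)
    let ?f = "case_sum Inl (\<lambda>i. if i = q then Inl p else Inr i) :: nat + nat \<Rightarrow> nat + nat"
    show f: "?f \<in> carr (bracket F B \<phi> A (Suc q)) \<rightarrow> carr (bracket F B' \<phi>' A q)"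
      by (auto simp: c cB')
    show inj: "inj_on ?f (carr (bracket F B \<phi> A (Suc q)))"
      using p by (auto simp: c inj_on_def split: if_splits)
    have split: "(\<exists>b\<in>carr B. z = Inl b) \<or> (\<exists>i<q. z = Inr i) \<or> z = Inr q"
      if "z \<in> carr (bracket F B \<phi> A (Suc q))" for z
      using that by (auto simp: c less_Suc_eq)
    show "uval (bracket F B' \<phi>' A q) (?f x) = uval (bracket F B \<phi> A (Suc q)) x"
      if x: "x \<in> carr (bracket F B \<phi> A (Suc q))" for x
    proof -
      have fx: "?f x \<in> carr (bracket F B' \<phi>' A q)" using f x by blast
      have e: "uval B' b = (if b = p then uval A q else uval B b)" if "b \<in> carr B'" for b
        using that unfolding cB' by (simp add: B'_def one_point_ext_def)
      show ?thesis
        unfolding uval_bracket[OF F B A q \<phi> x] uval_bracket[OF F B' A q0 \<phi>' fx]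
        using split[OF x] p by (elim disjE bexE exE conjE) (auto simp: e cB')
    qed
    show "rval (bracket F B' \<phi>' A q) (?f x) (?f y) = rval (bracket F B \<phi> A (Suc q)) x y"
      if x: "x \<in> carr (bracket F B \<phi> A (Suc q))" and y: "y \<in> carr (bracket F B \<phi> A (Suc q))"
        and xy: "x \<noteq> y" for x y
    proof -
      have "?f x \<in> carr (bracket F B' \<phi>' A q)" "?f y \<in> carr (bracket F B' \<phi>' A q)" "?f x \<noteq> ?f y"
        using f x y xy inj by (auto dest: inj_onD)
      note r = rval_bracket[OF F B' A q0 \<phi>' this] rval_bracket[OF F B A q \<phi> x y xy]
      \<comment> \<open>The coding node of \<open>q\<close> records only the values from smaller
        vertices to \<open>q\<close>; the opposite direction is recovered by
        \<open>F\<close>.\<close>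
      have fl: "rval A q i = F (rval A i q)" if "i < q" for i
        using that q by (intro rval_flip[OF A]) auto
      have ne: "b \<noteq> p" if "b \<in> carr B" for b using that p by blast
      have e: "rval B' a b = rval B a b" if "a \<in> carr B" "b \<in> carr B" "a \<noteq> b" for a b
        using that ne[OF that(1)] ne[OF that(2)] by (simp add: B'_def one_point_ext_def)
      \<comment> \<open>Labels have length \<open>Suc q\<close>, so the entry at \<open>q\<close> is
        the last one, which \<open>one_point_ext\<close> turned into a relation with
        \<open>p\<close>.\<close>
      have ep: "rval B' p b = \<phi> b ! q" "rval B' b p = F (\<phi> b ! q)" if "b \<in> carr B" for b
        using that ne[OF that] ne[OF that, symmetric] lab(1,3)[OF that]
        by (simp_all add: B'_def one_point_ext_def last_conv_nth)
      have nth: "\<phi>' b ! i = \<phi> b ! i" if "b \<in> carr B" "i < q" for b i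
        using that ne[OF that(1)] lab(1)[OF that(1)] by (simp add: \<phi>'_def nth_butlast)
      have nthp: "\<phi>' p ! i = rval A i q" if "i < q" for i
        using that by (simp add: \<phi>'_def ctc_def)
      show ?thesis
        unfolding r using split[OF x] split[OF y] xy
        by (elim disjE bexE exE conjE)
          (simp_all add: brval_def, (rule e, assumption+ | rule ep | simp_all only: nth nthp flip: fl; fail)+)
    qed
  qed
  moreover have "case_sum Inl (\<lambda>i. if i = q then Inl p else Inr i) ` carr (bracket F B \<phi> A (Suc q))
      = carr (bracket F B' \<phi>' A q)"
    by (simp add: c cB' image_Un image_image lessThan_Suc cong: image_cong_simp)
  ultimately show "isomorphism (bracket F B \<phi> A (Suc q)) (bracket F B' \<phi>' A q)
       (case_sum Inl (\<lambda>i. if i = q then Inl p else Inr i))"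
    by (simp add: isomorphism_def)
qed

section \<open>Age maps\<close>

lemma embedding_cong:
  assumes "\<And>x. x \<in> carr X \<Longrightarrow> f x = g x"
  shows "embedding X Y f \<longleftrightarrow> embedding X Y g"
  using assms unfolding embedding_def by (simp add: Pi_iff cong: inj_on_cong)

text \<open>Transport of structure: the values on the image are those of the preimages. It serves to
  prescribe the underlying set of an isomorphic copy.\<close>

lemma isomorphism_pushforward:
  assumes F: "is_flip k F" and B: "lstruct k F B" and inj: "inj_on g (carr B)"
  obtains Y where "lstruct k F Y" "isomorphism B Y g"
proof
  let ?e = "inv_into (carr B) g"
  let ?Y = "mkstr (g ` carr B) (\<lambda>a. uval B (?e a)) (\<lambda>a b. rval B (?e a) (?e b))"
  have e: "?e y \<in> carr B" "g (?e y) = y" if "y \<in> g ` carr B" for y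
    using that by (auto simp: inv_into_into f_inv_into_f)
  show Y: "lstruct k F ?Y"
  proof (rule lstruct_mkstr[OF F])
    fix a b assume a: "a \<in> g ` carr B"
    then show "uval B (?e a) < k" using e lstruct_uval(1)[OF B] by blast
    assume "b \<in> g ` carr B" "a \<noteq> b"
    then have "?e a \<in> carr B" "?e b \<in> carr B" "?e a \<noteq> ?e b" using a e by metis+
    then show "rval B (?e a) (?e b) < k" "rval B (?e b) (?e a) = F (rval B (?e a) (?e b))"
      by (rule lstruct_rval(1)[OF B], rule rval_flip[OF B])
  qed
  have "rval ?Y (g a) (g b) = rval B a b" if "a \<in> carr B" "b \<in> carr B" "a \<noteq> b" for a b
    using that inj by (simp add: inj_on_eq_iff)
  then have "embedding B ?Y g"
    unfolding embedding_iff_vals[OF B Y] using inj by simp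
  then show "isomorphism B ?Y g" by (simp add: isomorphism_def)
qed

locale coding_setting =
  fixes k :: nat and F :: "nat \<Rightarrow> nat" and \<K> :: "nat lstr set" and K A :: "nat lstr"
  assumes flip: "is_flip k F"
    and fraisse: "fraisse_class k F \<K>"
    and free: "free_amalgamation \<K>"
    and limit: "fraisse_limit k F \<K> K"
    and dense: "left_dense \<K> K"
    and enum: "enumerated k F A"
    and age: "age k F A \<subseteq> \<K>"
begin

section \<open>Membership in \<open>\<K>\<close>, and the structures \<open>K\<close> and
  \<open>A\<close>\<close>

lemma class_lstruct: "B \<in> \<K> \<Longrightarrow> lstruct k F B"
  using fraisse by (simp add: fraisse_class_def)

lemma class_hereditary: "B \<in> \<K> \<Longrightarrow> age k F B \<subseteq> \<K>"
  using fraisse by (simp add: fraisse_class_def hereditary_def)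

lemma class_iso: "B \<in> \<K> \<Longrightarrow> lstruct k F Y \<Longrightarrow> isomorphism B Y f \<Longrightarrow> Y \<in> \<K>"
  using fraisse unfolding fraisse_class_def by blast

text \<open>Left density speaks about members of \<open>\<K>\<close> with a specific carrier, while
  brackets live on a sum type. Transporting the witness \<open>B\<close> along \<open>j\<close>
  composed with the inverse of \<open>f\<close> yields a member with the carrier and the isomorphism
  that are wanted.\<close>

lemma in_class_realize:
  fixes j :: "'a \<Rightarrow> nat"
  assumes "in_class X \<K>" "inj_on j (carr X)"
  obtains Y where "Y \<in> \<K>" "isomorphism X Y j"
proof -
  obtain B f where B: "B \<in> \<K>" and f: "isomorphism X B f"
    using assms(1) by (auto simp: in_class_def)
  let ?g = "j \<circ> inv_into (carr X) f"
  have bij: "inj_on f (carr X)" "f ` carr X = carr B"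
    using f by (auto simp: isomorphism_def embedding_def)
  have "inj_on ?g (carr B)"
    using assms(2) bij by (auto intro!: comp_inj_on inj_on_inv_into inj_on_subset[OF assms(2)]
        simp: inv_into_into)
  then obtain Y where Y: "lstruct k F Y" "isomorphism B Y ?g"
    using isomorphism_pushforward[OF flip class_lstruct[OF B]] by blast
  have YK: "Y \<in> \<K>" using class_iso[OF B Y] .
  have iso: "isomorphism X Y (?g \<circ> f)" using isomorphism_comp[OF f Y(2)] .
  have "(?g \<circ> f) x = j x" if "x \<in> carr X" for x using that bij by simp
  then have "isomorphism X Y j"
    using iso embedding_cong[of X "?g \<circ> f" j Y] unfolding isomorphism_def
    by (metis image_cong)
  with YK show ?thesis by (rule that)
qed

text \<open>The image of \<open>X\<close> in a member of \<open>\<K>\<close> is an induced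
  substructure, hence a member by heredity, and \<open>X\<close> is isomorphic to it.\<close>

lemma in_class_embedding:
  assumes "in_class Y \<K>" "embedding X Y f"
  shows "in_class X \<K>"
proof -
  obtain B g where B: "B \<in> \<K>" and g: "isomorphism Y B g"
    using assms(1) by (auto simp: in_class_def)
  let ?S = "(g \<circ> f) ` carr X"
  have e: "embedding X B (g \<circ> f)"
    using assms(2) g by (auto simp: isomorphism_def intro: embedding_comp)
  have "finite (carr B)" using fraisse B by (simp add: fraisse_class_def)
  then have "induced B ?S \<in> age k F B"
    using lstruct_induced[OF flip class_lstruct[OF B]] embedding_induced
    by (auto simp: age_def)
  then have "induced B ?S \<in> \<K>"
    using class_hereditary[OF B] by blast
  moreover have "isomorphism X (induced B ?S) (g \<circ> f)"
    using e unfolding isomorphism_def embedding_def by (auto simp: induced_def Pi_iff)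
  ultimately show ?thesis by (auto simp: in_class_def)
qed

lemma in_class_isomorphism: "isomorphism X Y f \<Longrightarrow> in_class X \<K> \<longleftrightarrow> in_class Y \<K>"
  by (meson in_class_embedding isomorphism_def isomorphism_inv)

lemma in_class_member: "B \<in> \<K> \<Longrightarrow> in_class B \<K>"
proof -
  have "isomorphism B B id" by (simp add: isomorphism_def embedding_def)
  then show "B \<in> \<K> \<Longrightarrow> in_class B \<K>" by (auto simp: in_class_def)
qed

lemma K_lstruct: "lstruct k F K" and K_carr [simp]: "carr K = UNIV"
  using limit by (auto simp: fraisse_limit_def)

lemma A_lstruct: "lstruct k F A"
  using enum by (simp add: enumerated_def)

lemma A_carr: "enat m \<le> esize A \<Longrightarrow> {..<m} \<subseteq> carr A"
  using enum by (auto simp: enumerated_def) (meson enat_ord_simps(2) order_less_le_trans)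

lemma A_carr': "enat m < esize A \<Longrightarrow> {..m} \<subseteq> carr A" "enat m < esize A \<Longrightarrow> {..<Suc m} \<subseteq> carr A"
  using A_carr[of "Suc m"] by (auto simp: lessThan_Suc_atMost[symmetric] Suc_ile_eq)

lemma induced_K: "induced K {..<n} \<in> \<K>"
  using limit lstruct_induced[OF flip K_lstruct] embedding_induced
  by (auto simp: fraisse_limit_def age_def)

lemma induced_A: "induced A {..<n} \<in> \<K>"
proof -
  have "induced A {..<n} \<in> age k F A"
    using lstruct_induced[OF flip A_lstruct] embedding_induced by (auto simp: age_def)
  then show ?thesis using age by blast
qed

text \<open>The free amalgam of \<open>B[\<phi>, K_n]\<close> and \<open>K_{n'}\<close> over \<open>K_n\<close> is \<open>B[\<phi>', K_{n'}]\<close>.\<close>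

lemma in_class_pad:
  assumes B: "lstruct k F B" and \<phi>: "\<phi> \<in> carr B \<rightarrow> Tlev k n" and n: "n \<le> n'"
  defines "\<phi>' \<equiv> \<lambda>b. \<phi> b @ replicate (n' - n) 0"
  shows "in_class (bracket F B \<phi> K n) \<K> \<longleftrightarrow> in_class (bracket F B \<phi>' K n') \<K>"
proof -
  let ?P = "bracket F B \<phi> K n" and ?Q = "bracket F B \<phi>' K n'"
  have k0: "0 < k" "F 0 = 0" using flip by (auto simp: is_flip_def)
  have len: "length (\<phi> b) = n" if "b \<in> carr B" for b using that \<phi> by (auto simp: Tlev_def)
  have \<phi>': "\<phi>' \<in> carr B \<rightarrow> Tlev k n'"
    using \<phi> n k0 by (auto simp: \<phi>'_def intro!: pad_in_Tlev)
  have uK: "{..<i} \<subseteq> carr K" for i by simp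
  note P = carr_bracket[OF flip B K_lstruct uK \<phi>] lstruct_bracket[OF flip B K_lstruct uK \<phi>]
    uval_bracket[OF flip B K_lstruct uK \<phi>] rval_bracket[OF flip B K_lstruct uK \<phi>]
  note Q = carr_bracket[OF flip B K_lstruct uK \<phi>'] lstruct_bracket[OF flip B K_lstruct uK \<phi>']
    uval_bracket[OF flip B K_lstruct uK \<phi>'] rval_bracket[OF flip B K_lstruct uK \<phi>']
  have nth: "\<phi>' b ! i = (if i < n then \<phi> b ! i else 0)" if "b \<in> carr B" "i < n'" for b i
    using len[OF that(1)] that(2) n by (auto simp: \<phi>'_def nth_append)
  show ?thesis
  proof
    have sub: "x \<in> carr ?Q" if "x \<in> carr ?P" for x using that n by (auto simp: P(1) Q(1))
    \<comment> \<open>The padded labels agree with the old ones below \<open>n\<close>, so this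
      direction is heredity alone.\<close>
    have "embedding ?P ?Q id"
      unfolding embedding_iff_vals[OF P(2) Q(2)]
    proof (intro conjI ballI impI)
      fix x y assume x: "x \<in> carr ?P"
      show "uval ?Q (id x) = uval ?P x" using x sub by (simp add: P(3) Q(3))
      assume y: "y \<in> carr ?P" and "x \<noteq> y"
      then show "rval ?Q (id x) (id y) = rval ?P x y"
        using x n by (simp add: P(4) Q(4) sub) (auto simp: P(1) brval_def nth)
    qed (use sub in auto)
    then show "in_class ?Q \<K> \<Longrightarrow> in_class ?P \<K>" by (rule in_class_embedding[rotated])
  next
    \<comment> \<open>Amalgamation is stated for members of \<open>\<K>\<close>, so
      \<open>?P\<close> is replaced by its copy \<open>P'\<close>. The aim is an embedding of
      \<open>?Q\<close> into the free amalgam \<open>D\<close>; heredity then finishes.\<close>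
    assume "in_class ?P \<K>"
    then obtain P' p where P': "P' \<in> \<K>" and p: "isomorphism ?P P' p" by (auto simp: in_class_def)
    have pe: "embedding ?P P' p" and pim: "p ` carr ?P = carr P'"
      using p by (auto simp: isomorphism_def)
    let ?A0 = "induced K {..<n}" and ?C = "induced K {..<n'}"
    have A0: "lstruct k F ?A0" and C: "lstruct k F ?C"
      by (rule lstruct_induced[OF flip K_lstruct])+
    have "embedding ?A0 ?P Inr"
      unfolding embedding_iff_vals[OF A0 P(2)]
      by (auto simp: P(1,3,4) brval_def)
    then have "embedding ?A0 P' (p \<circ> Inr)" using pe by (rule embedding_comp)
    moreover have "embedding ?A0 ?C id"
      unfolding embedding_iff_vals[OF A0 C] using n by auto
    ultimately have "\<exists>D\<in>\<K>. \<exists>r s. embedding P' D r \<and> embedding ?C D s \<and>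
           (\<forall>a\<in>carr ?A0. r ((p \<circ> Inr) a) = s (id a)) \<and>
           carr D = r ` carr P' \<union> s ` carr ?C \<and>
           r ` carr P' \<inter> s ` carr ?C = (r \<circ> (p \<circ> Inr)) ` carr ?A0 \<and>
           (\<forall>a\<in>carr D. \<forall>b\<in>carr D.
              \<not> ({a, b} \<subseteq> r ` carr P' \<or> {a, b} \<subseteq> s ` carr ?C) \<longrightarrow> rval D a b = 0)"
      using free induced_K P' unfolding free_amalgamation_def by blast
    then obtain D r s where D: "D \<in> \<K>" and r: "embedding P' D r" and s: "embedding ?C D s"
      and rs': "\<forall>a\<in>carr ?A0. r ((p \<circ> Inr) a) = s (id a)"
      and int: "r ` carr P' \<inter> s ` carr ?C = (r \<circ> (p \<circ> Inr)) ` carr ?A0"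
      and zero: "\<forall>a\<in>carr D. \<forall>b\<in>carr D.
        \<not> ({a, b} \<subseteq> r ` carr P' \<or> {a, b} \<subseteq> s ` carr ?C) \<longrightarrow> rval D a b = 0"
      by (elim bexE exE conjE)
    have rs: "r (p (Inr a)) = s a" if "a < n" for a using rs' that by simp
    note Dl = class_lstruct[OF D]
    have rp: "embedding ?P D (r \<circ> p)" using pe r by (rule embedding_comp)
    note rp' = rp[unfolded embedding_iff_vals[OF P(2) Dl]]
    note s' = s[unfolded embedding_iff_vals[OF C Dl]]
    have sinj: "s i = s i' \<longleftrightarrow> i = i'" if "i < n'" "i' < n'" for i i'
      using inj_on_eq_iff[of s "carr ?C" i i'] s' that by simp
    have rinj: "r (p x) = r (p y) \<longleftrightarrow> x = y" if "x \<in> carr ?P" "y \<in> carr ?P" for x y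
      using inj_on_eq_iff[of "r \<circ> p" "carr ?P" x y] rp' that by simp
    have sD: "s i \<in> carr D" if "i < n'" for i using s' that by auto
    have rD: "r (p x) \<in> carr D" if "x \<in> carr ?P" for x using rp' that by auto
    have rval_s: "rval D (s i) (s i') = rval K i i'" if "i < n'" "i' < n'" "i \<noteq> i'" for i i'
      using s' that by auto
    have rval_r: "rval D (r (p x)) (r (p y)) = brval F B \<phi> K x y"
      if "x \<in> carr ?P" "y \<in> carr ?P" "x \<noteq> y" for x y
      using rp' that P(4)[OF that] by auto
    have InlP: "Inl b \<in> carr ?P" if "b \<in> carr B" for b using that by (simp add: P(1))
    have InrP: "Inr i \<in> carr ?P" if "i < n" for i using that by (simp add: P(1))
    \<comment> \<open>The two sides of a free amalgam meet only in the image of the base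
      \<open>K_n\<close>, so a labeled point never lies in the image of
      \<open>K_{n'}\<close>.\<close>
    have notboth: "x \<in> Inr ` {..<n}" if "x \<in> carr ?P" "r (p x) \<in> s ` carr ?C" for x
    proof -
      have "r (p x) \<in> (r \<circ> (p \<circ> Inr)) ` carr ?A0"
        using that pim by (subst int[symmetric]) auto
      then obtain a where a: "a < n" "r (p x) = r (p (Inr a))" by auto
      then have "x = Inr a" using rinj[OF that(1) InrP] by blast
      then show ?thesis using a by simp
    qed
    have rs_ne: "r (p (Inl b)) \<noteq> s i" if "b \<in> carr B" "i < n'" for b i
      using notboth[OF InlP[OF that(1)]] that by auto
    have old: "i < n" if i: "i < n'" and im: "s i \<in> r ` carr P'" for i
    proof -
      obtain x where x: "x \<in> carr ?P" "s i = r (p x)"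
        using im unfolding pim[symmetric] by auto
      moreover have "r (p x) \<in> s ` carr ?C" using i unfolding x(2)[symmetric] by simp
      ultimately obtain a where a: "a < n" "x = Inr a" using notboth by blast
      then have "s i = s a" using x rs by simp
      then show ?thesis using a i n sinj[of i a] by simp
    qed
    \<comment> \<open>For \<open>i < n\<close> both points lie in the image of \<open>P'\<close>,
      which gives the old label entry. For \<open>i \<ge> n\<close> neither side contains both
      points, so freeness gives \<open>0\<close> in both directions, in accordance with
      \<open>F 0 = 0\<close>.\<close>
    have cross: "rval D (s i) (r (p (Inl b))) = \<phi>' b ! i \<and> rval D (r (p (Inl b))) (s i) = F (\<phi>' b ! i)"
      if b: "b \<in> carr B" and i: "i < n'" for b i
    proof (cases "i < n")
      case True
      show ?thesis
        using rval_r[OF InlP[OF b] InrP[OF True]] rval_r[OF InrP[OF True] InlP[OF b]] rs[OF True]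
        by (simp add: brval_def nth b i True)
    next
      case False
      have "s i \<notin> r ` carr P'" using old[OF i] False by blast
      moreover have "r (p (Inl b)) \<notin> s ` carr ?C" using rs_ne[OF b] by auto
      ultimately have "rval D (s i) (r (p (Inl b))) = 0" "rval D (r (p (Inl b))) (s i) = 0"
        using zero sD[OF i] rD[OF InlP[OF b]] by blast+
      then show ?thesis using False k0 by (simp add: nth b i)
    qed
    let ?e = "case_sum (\<lambda>b. r (p (Inl b))) s"
    have "embedding ?Q D ?e"
      unfolding embedding_iff_vals[OF Q(2) Dl]
    proof (intro conjI ballI impI)
      show "?e \<in> carr ?Q \<rightarrow> carr D" using sD rD InlP by (auto simp: Q(1))
      show "inj_on ?e (carr ?Q)"
        using rs_ne rs_ne[symmetric] by (auto simp: inj_on_def Q(1) sinj rinj InlP)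
    next
      fix x assume x: "x \<in> carr ?Q"
      show "uval D (?e x) = uval ?Q x"
      proof (cases x)
        case (Inl b)
        then have b: "b \<in> carr B" using x by (auto simp: Q(1))
        have "uval D (r (p (Inl b))) = uval ?P (Inl b)" using rp' InlP[OF b] by simp
        then show ?thesis using P(3)[OF InlP[OF b]] Q(3)[OF x] Inl by simp
      next
        case (Inr i)
        then have "i < n'" using x by (auto simp: Q(1))
        then show ?thesis using s' Q(3)[OF x] Inr by simp
      qed
    next
      fix x y assume x: "x \<in> carr ?Q" and y: "y \<in> carr ?Q" and xy: "x \<noteq> y"
      show "rval D (?e x) (?e y) = rval ?Q x y"
        unfolding Q(4)[OF x y xy] using x y xy
        by (cases x; cases y) (auto simp: Q(1) brval_def cross rval_r rval_s InlP)
    qed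
    then show "in_class ?Q \<K>" by (rule in_class_embedding[OF in_class_member[OF D]])
  qed
qed

section \<open>Age maps between levels, expressed by brackets\<close>

lemma age_mapI:
  assumes "f \<in> Tlev k m \<rightarrow> Tlev k n" "inj_on f (Tlev k m)"
    and "\<And>B \<phi>. lstruct k F B \<Longrightarrow> finite (carr B) \<Longrightarrow> \<phi> \<in> carr B \<rightarrow> Tlev k m \<Longrightarrow>
      in_class (bracket F B \<phi> X m) \<K> \<longleftrightarrow> in_class (bracket F B (f \<circ> \<phi>) Y n) \<K>"
  shows "age_map k F (Tlev k m) (Cls k F \<K> X m) (Tlev k n) (Cls k F \<K> Y n) f"
  using assms(1,2) assms(3) unfolding age_map_def Cls_def labeled_strs_def
  by (auto simp: Pi_iff)

lemma age_mapD:
  assumes "age_map k F (Tlev k m) (Cls k F \<K> X m) (Tlev k n) (Cls k F \<K> Y n) f"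
  shows "f \<in> Tlev k m \<rightarrow> Tlev k n" "inj_on f (Tlev k m)"
    and "lstruct k F B \<Longrightarrow> finite (carr B) \<Longrightarrow> \<phi> \<in> carr B \<rightarrow> Tlev k m \<Longrightarrow>
      in_class (bracket F B \<phi> X m) \<K> \<longleftrightarrow> in_class (bracket F B (f \<circ> \<phi>) Y n) \<K>"
proof -
  show *: "f \<in> Tlev k m \<rightarrow> Tlev k n" "inj_on f (Tlev k m)"
    using assms by (auto simp: age_map_def)
  assume B: "lstruct k F B" "finite (carr B)" "\<phi> \<in> carr B \<rightarrow> Tlev k m"
  then have "(B, \<phi>) \<in> Cls k F \<K> X m \<longleftrightarrow> (B, f \<circ> \<phi>) \<in> Cls k F \<K> Y n"
    using assms by (auto simp: age_map_def labeled_strs_def)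
  moreover have "f \<circ> \<phi> \<in> carr B \<rightarrow> Tlev k n" using B(3) *(1) by auto
  ultimately show "in_class (bracket F B \<phi> X m) \<K> \<longleftrightarrow> in_class (bracket F B (f \<circ> \<phi>) Y n) \<K>"
    using B by (auto simp: Cls_def labeled_strs_def)
qed

text \<open>Vertex \<open>q\<close> of \<open>A\<close> and vertex \<open>n\<close> of
  \<open>K\<close> are absorbed into \<open>B\<close> as the same new point \<open>p\<close>. Since
  \<open>succ_map f\<close> keeps last entries and the unary values agree, both sides yield the same
  enlarged structure; since \<open>f\<close> maps \<open>ctc A q\<close> to \<open>ctc K n\<close>,
  their labelings correspond under \<open>f\<close>. One application of the age map property of
  \<open>f\<close> to the enlarged structure then suffices.\<close>

lemma age_map_succ_map:
  assumes q: "enat q < esize A"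
    and f: "age_map k F (Tlev k q) (Cls k F \<K> A q) (Tlev k n) (Cls k F \<K> K n) f"
    and c: "f (ctc A q) = ctc K n" and u: "ctu A q = ctu K n"
  shows "age_map k F (Tlev k (Suc q)) (Cls k F \<K> A (Suc q))
    (Tlev k (Suc n)) (Cls k F \<K> K (Suc n)) (succ_map f)"
proof (rule age_mapI)
  note f' = age_mapD[OF f]
  show im: "succ_map f \<in> Tlev k (Suc q) \<rightarrow> Tlev k (Suc n)"
    using f'(1) by (auto simp: Tlev_Suc succ_map_def)
  show "inj_on (succ_map f) (Tlev k (Suc q))"
  proof (rule inj_onI)
    fix s t assume s: "s \<in> Tlev k (Suc q)" and t: "t \<in> Tlev k (Suc q)"
      and "succ_map f s = succ_map f t"
    then have "butlast s = butlast t" "last s = last t"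
      using inj_onD[OF f'(2)] by (auto simp: succ_map_def Tlev_Suc)
    then show "s = t" using s t by (metis Tlev_Suc append_butlast_last_id)
  qed
  fix B :: "nat lstr" and \<phi> assume B: "lstruct k F B" "finite (carr B)" and \<phi>: "\<phi> \<in> carr B \<rightarrow> Tlev k (Suc q)"
  obtain p where p: "p \<notin> carr B" using ex_new_if_finite[OF infinite_UNIV_nat B(2)] by auto
  have s\<phi>: "succ_map f \<circ> \<phi> \<in> carr B \<rightarrow> Tlev k (Suc n)" using im \<phi> by auto
  let ?B' = "one_point_ext F B p (uval A q) (last \<circ> \<phi>)"
  let ?\<phi>' = "\<lambda>b. if b = p then ctc A q else butlast (\<phi> b)"
  have K': "{..<Suc n} \<subseteq> carr K" by simp
  note a = bracket_Suc_isomorphism[OF flip B(1) p A_lstruct A_carr'(2)[OF q] \<phi>]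
  note b = bracket_Suc_isomorphism[OF flip B(1) p K_lstruct K' s\<phi>]
  have "one_point_ext F B p (uval K n) (last \<circ> (succ_map f \<circ> \<phi>)) = ?B'"
    using u by (simp add: ctu_def succ_map_def comp_def)
  moreover have "(\<lambda>b. if b = p then ctc K n else butlast ((succ_map f \<circ> \<phi>) b)) = f \<circ> ?\<phi>'"
    using c by (auto simp: succ_map_def)
  moreover have "finite (carr ?B')" using B(2) by (simp add: one_point_ext_def)
  ultimately show "in_class (bracket F B \<phi> A (Suc q)) \<K> \<longleftrightarrow>
      in_class (bracket F B (succ_map f \<circ> \<phi>) K (Suc n)) \<K>"
    using in_class_isomorphism[OF a(3)] in_class_isomorphism[OF b(3)] f'(3)[OF a(1) _ a(2)]
    by simp
qed

lemma age_map_to_coding_node: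
  assumes m: "enat m < esize A"
    and \<sigma>: "age_map k F (Tlev k m) (Cls k F \<K> A m) (Tlev k n) (Cls k F \<K> K n) \<sigma>"
  obtains n' where "n \<le> n'" "\<sigma> (ctc A m) @ replicate (n' - n) 0 = ctc K n'" "ctu A m = ctu K n'"
    "age_map k F (Tlev k m) (Cls k F \<K> A m) (Tlev k n') (Cls k F \<K> K n')
       (\<lambda>t. \<sigma> t @ replicate (n' - n) 0)"
proof -
  note \<sigma>' = age_mapD[OF \<sigma>]
  \<comment> \<open>A single point labeled by the coding node of \<open>m\<close>: its bracket over
    \<open>A_m\<close> is a copy of \<open>A_{m+1}\<close>. The binary value \<open>0\<close> is a
    dummy, as there are no distinct points.\<close>
  let ?B = "mkstr {0::nat} (\<lambda>_. uval A m) (\<lambda>_ _. 0)"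
  let ?\<phi> = "\<lambda>_::nat. ctc A m"
  have mA: "m \<in> carr A" "{..<m} \<subseteq> carr A" using A_carr'[OF m] by auto
  have cA: "ctc A m \<in> Tlev k m" by (rule ctc_in_Tlev[OF A_lstruct A_carr'(1)[OF m]])
  have B: "lstruct k F ?B" using mA lstruct_uval(1)[OF A_lstruct] by (intro lstruct_mkstr[OF flip]) auto
  have \<phi>: "?\<phi> \<in> carr ?B \<rightarrow> Tlev k m" "\<sigma> \<circ> ?\<phi> \<in> carr ?B \<rightarrow> Tlev k n"
    using cA \<sigma>'(1) by auto
  have uK: "{..<n} \<subseteq> carr K" by simp
  note P = carr_bracket[OF flip B A_lstruct mA(2) \<phi>(1)] lstruct_bracket[OF flip B A_lstruct mA(2) \<phi>(1)]
    uval_bracket[OF flip B A_lstruct mA(2) \<phi>(1)] rval_bracket[OF flip B A_lstruct mA(2) \<phi>(1)]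
  note Q = carr_bracket[OF flip B K_lstruct uK \<phi>(2)] lstruct_bracket[OF flip B K_lstruct uK \<phi>(2)]
    uval_bracket[OF flip B K_lstruct uK \<phi>(2)] rval_bracket[OF flip B K_lstruct uK \<phi>(2)]
  have "embedding (bracket F ?B ?\<phi> A m) (induced A {..<Suc m}) (case_sum (\<lambda>_. m) id)"
    unfolding embedding_iff_vals[OF P(2) lstruct_induced[OF flip A_lstruct]]
  proof (intro conjI ballI impI)
    show "case_sum (\<lambda>_. m) id \<in> carr (bracket F ?B ?\<phi> A m) \<rightarrow> carr (induced A {..<Suc m})"
      using mA by (auto simp: P(1))
    show "inj_on (case_sum (\<lambda>_. m) id) (carr (bracket F ?B ?\<phi> A m))"
      by (auto simp: P(1) inj_on_def)
    fix x y assume x: "x \<in> carr (bracket F ?B ?\<phi> A m)"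
    show "uval (induced A {..<Suc m}) (case_sum (\<lambda>_. m) id x) = uval (bracket F ?B ?\<phi> A m) x"
      unfolding P(3)[OF x] using x by (auto simp: P(1))
    assume y: "y \<in> carr (bracket F ?B ?\<phi> A m)" and xy: "x \<noteq> y"
    have xy': "x \<in> Inl ` {0} \<union> Inr ` {..<m}" "y \<in> Inl ` {0} \<union> Inr ` {..<m}"
      using x y by (simp_all add: P(1))
    have "rval A m i = F (rval A i m)" if "i < m" for i
      using that mA by (intro rval_flip[OF A_lstruct]) auto
    then show "rval (induced A {..<Suc m}) (case_sum (\<lambda>_. m) id x) (case_sum (\<lambda>_. m) id y) =
        rval (bracket F ?B ?\<phi> A m) x y"
      unfolding P(4)[OF x y xy] using xy' xy by (auto simp: brval_def ctc_def)
  qed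
  then have "in_class (bracket F ?B ?\<phi> A m) \<K>"
    by (rule in_class_embedding[OF in_class_member[OF induced_A]])
  then have in_cls: "in_class (bracket F ?B (\<sigma> \<circ> ?\<phi>) K n) \<K>"
    using \<sigma>'(3)[OF B _ \<phi>(1)] by simp
  \<comment> \<open>The map \<open>?j\<close> sends the labeled point to \<open>n\<close> and fixes
    the vertices below \<open>n\<close>, which produces the carrier \<open>{..<Suc n}\<close> that
    left density asks for.\<close>
  let ?Q = "bracket F ?B (\<sigma> \<circ> ?\<phi>) K n" and ?j = "case_sum (\<lambda>_. n) id :: nat + nat \<Rightarrow> nat"
  have "inj_on ?j (carr ?Q)" by (auto simp: Q(1) inj_on_def)
  with in_cls obtain A' where A': "A' \<in> \<K>" and iso: "isomorphism ?Q A' ?j"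
    by (rule in_class_realize)
  note A'l = class_lstruct[OF A']
  have "embedding ?Q A' ?j" using iso by (simp add: isomorphism_def)
  note j = this[unfolded embedding_iff_vals[OF Q(2) A'l], THEN conjunct2, THEN conjunct2]
  have jU: "uval A' (?j x) = uval ?Q x" if "x \<in> carr ?Q" for x
    using j that by blast
  have jR: "rval A' (?j x) (?j y) = rval ?Q x y" if "x \<in> carr ?Q" "y \<in> carr ?Q" "x \<noteq> y" for x y
    using j that by blast
  have "?j ` carr ?Q = {..<Suc n}" by (simp add: Q(1) image_Un image_image lessThan_Suc)
  then have cA': "carr A' = {..<Suc n}" using iso by (simp add: isomorphism_def)
  have Q0: "Inl 0 \<in> carr ?Q" by (simp add: Q(1))
  have Qr: "Inr i \<in> carr ?Q" if "i < n" for i using that by (simp add: Q(1))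
  have uA': "uval A' i = uval K i" if "i < n" for i
    using jU[OF Qr[OF that]] Q(3)[OF Qr[OF that]] by simp
  have uA'n: "uval A' n = uval A m"
    using jU[OF Q0] Q(3)[OF Q0] by simp
  have rA': "rval A' i i' = rval K i i'" if "i < n" "i' < n" "i \<noteq> i'" for i i'
    using jR[OF Qr[OF that(1)] Qr[OF that(2)]] Q(4)[OF Qr[OF that(1)] Qr[OF that(2)]] that(3)
    by (simp add: brval_def)
  have rA'n: "rval A' i n = \<sigma> (ctc A m) ! i" if "i < n" for i
    using jR[OF Qr[OF that] Q0] Q(4)[OF Qr[OF that] Q0] by (simp add: brval_def)
  \<comment> \<open>Left density requires equality of the two records, not just an isomorphism,
    hence the passage through \<open>mkstr\<close>.\<close>
  have ind: "induced A' {..<n} = induced K {..<n}"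
    unfolding induced_eq_mkstr[OF A'l] induced_eq_mkstr[OF K_lstruct] cA'
    by (auto simp: mkstr_def fun_eq_iff uA' rA')
  obtain n' where n': "n \<le> n'" and e: "embedding A' K (\<lambda>i. if i < n then i else n')"
    and zero: "\<forall>r. n \<le> r \<and> r < n' \<longrightarrow> rval K r n' = 0"
    using dense[unfolded left_dense_def, THEN spec, of n, THEN bspec, OF A', THEN mp,
        OF conjI[OF cA' ind]] by blast
  note e' = e[unfolded embedding_iff_vals[OF A'l K_lstruct] cA', THEN conjunct2, THEN conjunct2]
  have "uval K n' = uval A' n"
    using bspec[OF e'[THEN conjunct1], of n] by simp
  then have u: "ctu A m = ctu K n'" by (simp add: ctu_def uA'n)
  have rn': "rval K i n' = \<sigma> (ctc A m) ! i" if "i < n" for i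
    using bspec[OF bspec[OF e'[THEN conjunct2], of i], of n] that rA'n[OF that] by simp
  have len: "length (\<sigma> (ctc A m)) = n" using cA \<sigma>'(1) by (auto simp: Tlev_def)
  \<comment> \<open>Entries below \<open>n\<close> come from the embedding of \<open>A'\<close>,
    those from \<open>n\<close> on from the zero clause of left density.\<close>
  have c: "\<sigma> (ctc A m) @ replicate (n' - n) 0 = ctc K n'"
  proof (rule nth_equalityI)
    show "length (\<sigma> (ctc A m) @ replicate (n' - n) 0) = length (ctc K n')"
      using n' by (simp add: len) (simp add: ctc_def)
    fix i assume "i < length (\<sigma> (ctc A m) @ replicate (n' - n) 0)"
    then have i: "i < n'" using n' by (simp add: len)
    then have "ctc K n' ! i = rval K i n'" by (simp add: ctc_def)
    then show "(\<sigma> (ctc A m) @ replicate (n' - n) 0) ! i = ctc K n' ! i"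
      using i zero by (simp add: nth_append len rn')
  qed
  have k0: "0 < k" using flip by (simp add: is_flip_def)
  have "age_map k F (Tlev k m) (Cls k F \<K> A m) (Tlev k n') (Cls k F \<K> K n')
       (\<lambda>t. \<sigma> t @ replicate (n' - n) 0)"
  proof (rule age_mapI)
    show "(\<lambda>t. \<sigma> t @ replicate (n' - n) 0) \<in> Tlev k m \<rightarrow> Tlev k n'"
      using \<sigma>'(1) n' k0 by (auto intro!: pad_in_Tlev)
    show "inj_on (\<lambda>t. \<sigma> t @ replicate (n' - n) 0) (Tlev k m)"
      using \<sigma>'(2) by (auto simp: inj_on_def)
    fix B :: "nat lstr" and \<phi> assume B: "lstruct k F B" "finite (carr B)" "\<phi> \<in> carr B \<rightarrow> Tlev k m"
    then have "\<sigma> \<circ> \<phi> \<in> carr B \<rightarrow> Tlev k n" using \<sigma>'(1) by auto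
    then show "in_class (bracket F B \<phi> A m) \<K> \<longleftrightarrow>
        in_class (bracket F B ((\<lambda>t. \<sigma> t @ replicate (n' - n) 0) \<circ> \<phi>) K n') \<K>"
      using \<sigma>'(3)[OF B] in_class_pad[OF B(1) _ n'] by (simp add: comp_def)
  qed
  with n' c u show ?thesis by (intro that)
qed

section \<open>Aged embeddings, level by level\<close>

lemma replicate_in_Tlev: "replicate j 0 \<in> Tlev k j"
  using flip by (auto simp: Tlev_def T_def is_flip_def)

text \<open>The all-zero sequence is a node available on every level, as \<open>0 < k\<close>. Its
  image reveals the level function of \<open>f\<close>, so that no existential quantifier over level
  functions has to be carried along.\<close>

definition height :: "(nat list \<Rightarrow> nat list) \<Rightarrow> nat \<Rightarrow> nat" where
  "height f j = length (f (replicate j 0))"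

text \<open>The part of being an aged embedding that concerns level \<open>q\<close>. It depends on
  \<open>f\<close> only up to length \<open>q\<close>, so it survives any change of \<open>f\<close>
  on longer sequences.\<close>

definition aged_at :: "(nat list \<Rightarrow> nat list) \<Rightarrow> nat \<Rightarrow> bool" where
  "aged_at f q \<longleftrightarrow>
     age_map k F (Tlev k q) (Cls k F \<K> A q) (Tlev k (height f q)) (Cls k F \<K> K (height f q)) f \<and>
     f (ctc A q) = ctc K (height f q) \<and> ctu A q = ctu K (height f q) \<and>
     (\<forall>s i. s @ [i] \<in> Tlev k q \<longrightarrow> prefix (f s @ [i]) (f (s @ [i])))"

lemma level_fun_height:
  assumes "level_fun k M f h" "enat j < M"
  shows "h j = height f j"
  using assms replicate_in_Tlev[of j] by (force simp: level_fun_def height_def Tlev_def)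

lemma aged_at_prefix: "aged_at f q \<Longrightarrow> s @ [i] \<in> Tlev k q \<Longrightarrow> prefix (f s @ [i]) (f (s @ [i]))"
  unfolding aged_at_def by blast

text \<open>The one-letter condition is iterated along \<open>u\<close>: once \<open>f\<close> has
  left \<open>f w\<close> in direction \<open>x\<close>, further letters only lengthen the
  image.\<close>

lemma prefix_if_aged_at:
  assumes "\<And>q. enat q < M \<Longrightarrow> aged_at f q" "w @ x # u \<in> Tbelow k M"
  shows "prefix (f w @ [x]) (f (w @ x # u))"
  using assms(2)
proof (induction u rule: rev_induct)
  case Nil
  then have "w @ [x] \<in> Tlev k (Suc (length w))" "enat (Suc (length w)) < M"
    by (auto simp: Tbelow_def Tlev_def)
  then show ?case using aged_at_prefix assms(1) by blast
next
  case (snoc y u)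
  let ?t = "w @ x # u"
  have t: "?t @ [y] \<in> Tlev k (Suc (length ?t))" "enat (Suc (length ?t)) < M"
    using snoc.prems by (auto simp: Tbelow_def Tlev_def)
  have "prefix (f ?t @ [y]) (f (?t @ [y]))" by (rule aged_at_prefix[OF assms(1)[OF t(2)] t(1)])
  moreover have "?t \<in> Tbelow k M"
    using snoc.prems by (auto simp: Tbelow_def T_def elim: order.strict_trans[rotated])
  then have "prefix (f w @ [x]) (f ?t)" by (rule snoc.IH)
  ultimately show ?case
    using prefix_order.trans[OF _ append_prefixD] by simp
qed

lemma longest_common_prefix_append:
  "longest_common_prefix (w @ a) (w @ b) = w @ longest_common_prefix a b"
  by (induction w) auto

lemma longest_common_prefix_Nil_iff:
  "longest_common_prefix a b = [] \<longleftrightarrow> a = [] \<or> b = [] \<or> hd a \<noteq> hd b"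
  by (cases a; cases b) auto

text \<open>The conditions on meets, injectivity and levels all follow from \<open>f(s i) \<sqsupseteq> f(s) i\<close>.\<close>

lemma ct_embedding_if_aged_at:
  assumes aged: "\<And>q. enat q < M \<Longrightarrow> aged_at f q"
  shows "ct_embedding k A M K f (height f)"
proof -
  have pre: "prefix (f w @ [x]) (f (w @ x # u))" if "w @ x # u \<in> Tbelow k M" for w x u
    using aged that by (rule prefix_if_aged_at)
  have lev: "f ` Tlev k j \<subseteq> Tlev k (height f j)" if "enat j < M" for j
    using aged[OF that] by (auto simp: aged_at_def age_map_def)
  have T: "f s \<in> T k" if "s \<in> Tbelow k M" for s
    using that lev[of "length s"] by (auto simp: Tbelow_def Tlev_def)
  have longer: "length (f w) < length (f (w @ u))" if wu: "w @ u \<in> Tbelow k M" and "u \<noteq> []" for w u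
  proof -
    obtain x v where "u = x # v" using \<open>u \<noteq> []\<close> by (cases u) auto
    then show ?thesis using prefix_length_le[OF pre[of w x v]] wu by simp
  qed
  have mono: "strict_mono_on {j. enat j < M} (height f)"
  proof (rule strict_mono_onI)
    fix i j assume "j \<in> {j. enat j < M}" "i < j"
    moreover from this have "replicate j 0 = replicate i (0::nat) @ replicate (j - i) 0"
      by (simp add: replicate_add[symmetric])
    ultimately show "height f i < height f j"
      using longer[of "replicate i 0" "replicate (j - i) 0"] replicate_in_Tlev[of j]
      by (simp add: height_def Tbelow_def Tlev_def)
  qed
  have meet: "f (longest_common_prefix s t) = longest_common_prefix (f s) (f t)"
    if s: "s \<in> Tbelow k M" and t: "t \<in> Tbelow k M" for s t
  proof -
    let ?w = "longest_common_prefix s t"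
    obtain a b where a: "s = ?w @ a" and b: "t = ?w @ b"
      using longest_common_prefix_prefix1[of s t] longest_common_prefix_prefix2[of s t]
      by (auto elim!: prefixE)
    \<comment> \<open>Beyond \<open>f ?w\<close>, the image continues with the first letter of
      \<open>u\<close>. Two sequences that part at \<open>?w\<close> therefore have images that part
      at \<open>f ?w\<close>, and if one of them ends there, so does its image.\<close>
    have ext: "\<exists>r. f (?w @ u) = f ?w @ r \<and> (r = [] \<or> u \<noteq> [] \<and> hd r = hd u) \<and> (u = [] \<longrightarrow> r = [])"
      if wu: "?w @ u \<in> Tbelow k M" for u
    proof (cases u)
      case Nil then show ?thesis by simp
    next
      case (Cons x v)
      then obtain r where "f (?w @ u) = (f ?w @ [x]) @ r"
        using pre[of ?w x v] wu by (auto elim: prefixE)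
      then show ?thesis using Cons by auto
    qed
    obtain c where c: "f s = f ?w @ c" "c = [] \<or> a \<noteq> [] \<and> hd c = hd a"  "a = [] \<longrightarrow> c = []"
      using ext[of a] s unfolding a[symmetric] by blast
    obtain d where d: "f t = f ?w @ d" "d = [] \<or> b \<noteq> [] \<and> hd d = hd b"  "b = [] \<longrightarrow> d = []"
      using ext[of b] t unfolding b[symmetric] by blast
    have "?w = ?w @ longest_common_prefix a b"
      using longest_common_prefix_append[of ?w a b] a b by simp
    then have "a = [] \<or> b = [] \<or> hd a \<noteq> hd b"
      by (simp add: longest_common_prefix_Nil_iff)
    then have "longest_common_prefix c d = []"
      using c d by (auto simp: longest_common_prefix_Nil_iff)
    then show ?thesis using c(1) d(1) by (simp add: longest_common_prefix_append)
  qed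
  have inj: "inj_on f (Tbelow k M)"
  proof (rule inj_onI)
    fix s t assume s: "s \<in> Tbelow k M" and t: "t \<in> Tbelow k M" and eq: "f s = f t"
    let ?w = "longest_common_prefix s t"
    obtain a b where a: "s = ?w @ a" and b: "t = ?w @ b"
      using longest_common_prefix_prefix1[of s t] longest_common_prefix_prefix2[of s t]
      by (auto elim!: prefixE)
    have "longest_common_prefix (f t) (f t) = f t"
      using longest_common_prefix_append[of "f t" "[]" "[]"] by simp
    then have w: "f ?w = f s" "f ?w = f t" using meet[OF s t] eq by simp_all
    have "a = []" using longer[of ?w a] s w(1) unfolding a[symmetric] by fastforce
    moreover have "b = []" using longer[of ?w b] t w(2) unfolding b[symmetric] by fastforce
    ultimately show "s = t" using a b by simp
  qed
  have succ: "prefix (f s @ [i]) (f (s @ [i]))" if "s @ [i] \<in> Tbelow k M" for s i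
    using pre[OF that] .
  have code: "f (ctc A j) = ctc K (height f j) \<and> ctu A j = ctu K (height f j)" if "enat j < M" for j
    using aged[OF that] by (simp add: aged_at_def)
  show ?thesis
    unfolding ct_embedding_def level_fun_def using T inj mono lev meet succ code by blast
qed

text \<open>Any admissible level function coincides with \<open>height f\<close> below
  \<open>M\<close>, and the global conditions follow from the levelwise ones. This turns
  \<open>AEmb\<close> into a conjunction over levels, for finite and infinite \<open>M\<close>
  alike.\<close>

lemma AEmb_iff: "f \<in> AEmb k F \<K> A M K \<longleftrightarrow> (\<forall>q. enat q < M \<longrightarrow> aged_at f q)"
proof
  assume "f \<in> AEmb k F \<K> A M K"
  then obtain h where h: "ct_embedding k A M K f h"
    and am: "\<And>j. enat j < M \<Longrightarrow>
      age_map k F (Tlev k j) (Cls k F \<K> A j) (Tlev k (h j)) (Cls k F \<K> K (h j)) f"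
    by (auto simp: AEmb_def)
  show "\<forall>q. enat q < M \<longrightarrow> aged_at f q"
  proof (intro allI impI)
    fix q assume q: "enat q < M"
    have "level_fun k M f h" using h by (simp add: ct_embedding_def)
    then have hq: "h q = height f q" using q by (rule level_fun_height)
    have "prefix (f s @ [i]) (f (s @ [i]))" if "s @ [i] \<in> Tlev k q" for s i
      using h that q by (auto simp: ct_embedding_def Tbelow_def Tlev_def)
    moreover have "f (ctc A q) = ctc K (h q) \<and> ctu A q = ctu K (h q)"
      using h q by (simp add: ct_embedding_def)
    ultimately show "aged_at f q" using am[OF q] by (simp add: aged_at_def hq)
  qed
next
  assume "\<forall>q. enat q < M \<longrightarrow> aged_at f q"
  then show "f \<in> AEmb k F \<K> A M K"
    using ct_embedding_if_aged_at[of M f] unfolding AEmb_def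
    by (auto intro!: exI[of _ "height f"] simp: aged_at_def)
qed

section \<open>Extension by one level and passage to the limit\<close>

lemma bracket_cong:
  assumes "\<And>b. b \<in> carr B \<Longrightarrow> \<phi> b = \<psi> b"
  shows "bracket F B \<phi> X m = bracket F B \<psi> X m"
  using assms by (simp add: bracket_def Let_def cong: conj_cong)

lemma age_map_cong:
  assumes "\<And>t. t \<in> Tlev k m \<Longrightarrow> f t = g t"
    and f: "age_map k F (Tlev k m) (Cls k F \<K> X m) (Tlev k n) (Cls k F \<K> Y n) f"
  shows "age_map k F (Tlev k m) (Cls k F \<K> X m) (Tlev k n) (Cls k F \<K> Y n) g"
proof (rule age_mapI)
  show "g \<in> Tlev k m \<rightarrow> Tlev k n" "inj_on g (Tlev k m)"
    using age_mapD(1,2)[OF f] assms(1) by (auto simp: inj_on_def Pi_iff)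
  fix B :: "nat lstr" and \<phi> assume B: "lstruct k F B" "finite (carr B)" "\<phi> \<in> carr B \<rightarrow> Tlev k m"
  have "bracket F B (f \<circ> \<phi>) Y n = bracket F B (g \<circ> \<phi>) Y n"
    using B(3) assms(1) by (intro bracket_cong) auto
  then show "in_class (bracket F B \<phi> X m) \<K> \<longleftrightarrow> in_class (bracket F B (g \<circ> \<phi>) Y n) \<K>"
    using age_mapD(3)[OF f B] by simp
qed

text \<open>Agreement on level \<open>q\<close> alone would not do: the successor clause also reads
  the values on the level below.\<close>

lemma aged_at_cong:
  assumes q: "enat q < esize A" and eq: "\<And>t. t \<in> T k \<Longrightarrow> length t \<le> q \<Longrightarrow> f t = g t"
    and f: "aged_at f q"
  shows "aged_at g q"
proof -
  have lev: "f t = g t" if "t \<in> Tlev k q" for t using that eq by (simp add: Tlev_def)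
  have h: "height g q = height f q" using lev[OF replicate_in_Tlev] by (simp add: height_def)
  have "prefix (g s @ [i]) (g (s @ [i]))" if "s @ [i] \<in> Tlev k q" for s i
  proof -
    have "s \<in> T k" "length s \<le> q" using that by (auto simp: Tlev_def T_def)
    then show ?thesis using aged_at_prefix[OF f that] lev[OF that] eq[of s] by simp
  qed
  moreover have "f (ctc A q) = g (ctc A q)" by (intro lev ctc_in_Tlev[OF A_lstruct A_carr'(1)[OF q]])
  moreover have "age_map k F (Tlev k q) (Cls k F \<K> A q) (Tlev k (height f q))
      (Cls k F \<K> K (height f q)) g"
    using f by (intro age_map_cong[OF lev]) (auto simp: aged_at_def)
  ultimately show ?thesis
    using f lev unfolding aged_at_def h by auto
qed

text \<open>The age map \<open>\<sigma>\<close> is kept abstract so that one argument covers three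
  uses: the identity at the root, \<open>succ_map f\<close>, and
  \<open>\<gamma> \<circ> succ_map f\<close>. Only the values on level \<open>m\<close> are changed,
  to \<open>\<sigma>\<close> followed by the zeros leading to a coding node.\<close>

lemma aged_at_extend:
  assumes m: "enat m < esize A" and f: "\<forall>q<m. aged_at f q"
    and \<sigma>: "age_map k F (Tlev k m) (Cls k F \<K> A m) (Tlev k n) (Cls k F \<K> K n) \<sigma>"
    and pre: "\<forall>s i. s @ [i] \<in> Tlev k m \<longrightarrow> prefix (f s @ [i]) (\<sigma> (s @ [i]))"
  shows "\<exists>g. (\<forall>q\<le>m. aged_at g q) \<and> (\<forall>t. length t < m \<longrightarrow> g t = f t) \<and>
    (\<forall>t\<in>Tlev k m. prefix (\<sigma> t) (g t))"
proof -
  obtain n' where n': "\<sigma> (ctc A m) @ replicate (n' - n) 0 = ctc K n'" "ctu A m = ctu K n'"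
    and am: "age_map k F (Tlev k m) (Cls k F \<K> A m) (Tlev k n') (Cls k F \<K> K n')
       (\<lambda>t. \<sigma> t @ replicate (n' - n) 0)"
    using age_map_to_coding_node[OF m \<sigma>] by blast
  let ?g = "\<lambda>t. if length t = m then \<sigma> t @ replicate (n' - n) 0 else f t"
  have am': "age_map k F (Tlev k m) (Cls k F \<K> A m) (Tlev k n') (Cls k F \<K> K n') ?g"
    by (rule age_map_cong[OF _ am]) (simp add: Tlev_def)
  have h: "height ?g m = n'"
    using age_mapD(1)[OF am'] replicate_in_Tlev[of m] by (force simp: height_def Tlev_def)
  have "prefix (?g s @ [i]) (?g (s @ [i]))" if "s @ [i] \<in> Tlev k m" for s i
    using pre[rule_format, OF that] that by (auto simp: Tlev_def intro: prefix_order.trans)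
  then have "aged_at ?g m"
    using am' n' unfolding aged_at_def h by (simp add: ctc_def)
  moreover have "aged_at ?g q" if "q < m" for q
    using that by (intro aged_at_cong[OF _ _ f[rule_format, OF that]] order.strict_trans[OF _ m]) auto
  ultimately have "\<forall>q\<le>m. aged_at ?g q" using le_neq_implies_less by blast
  then show ?thesis by (intro exI[of _ ?g]) (simp add: Tlev_def)
qed

lemma ex_aged_at_Suc:
  assumes m: "enat m < esize A" and f: "\<forall>q<m. aged_at f q"
  shows "\<exists>g. (\<forall>q\<le>m. aged_at g q) \<and> (\<forall>t. length t < m \<longrightarrow> g t = f t)"
proof (cases m)
  case 0
  \<comment> \<open>At the root there is no preceding level to extend. The substructures of
    \<open>A\<close> and \<open>K\<close> on no vertices coincide, so the identity is an age map
    there.\<close>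
  have "bracket F B \<phi> A 0 = bracket F B \<phi> K 0" for B \<phi>
    by (simp add: bracket_def induced_def)
  then have "age_map k F (Tlev k m) (Cls k F \<K> A m) (Tlev k 0) (Cls k F \<K> K 0) id"
    unfolding 0 by (intro age_mapI) auto
  from aged_at_extend[OF m f this] show ?thesis by (auto simp: 0 Tlev_def)
next
  case (Suc p)
  then have p: "enat p < esize A" and "aged_at f p"
    using f m by (auto intro: order.strict_trans[OF _ m])
  then have "age_map k F (Tlev k m) (Cls k F \<K> A m) (Tlev k (Suc (height f p)))
      (Cls k F \<K> K (Suc (height f p))) (succ_map f)"
    unfolding Suc by (intro age_map_succ_map[OF p]) (auto simp: aged_at_def)
  from aged_at_extend[OF m f this] show ?thesis by (auto simp: succ_map_def)
qed

text \<open>Dependent choice gives stages \<open>e j\<close> that are aged below \<open>j\<close>,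
  each agreeing with its predecessor on sequences shorter than \<open>j\<close>; the embedding is
  their levelwise limit. The guard \<open>enat j \<le> esize A\<close> makes the requirement vacuous
  past the end of a finite \<open>A\<close>, so the sequence can always be continued.\<close>

lemma AEmb_nonempty: "AEmb k F \<K> A (esize A) K \<noteq> {}"
proof -
  let ?P = "\<lambda>j f. enat j \<le> esize A \<longrightarrow> (\<forall>q<j. aged_at f q)"
  let ?Q = "\<lambda>j f g. \<forall>t. length t < j \<longrightarrow> g t = (f t :: nat list)"
  have "\<exists>g. ?P (Suc j) g \<and> ?Q j f g" if "?P j f" for j f
  proof (cases "enat j < esize A")
    case True
    then have "\<forall>q<j. aged_at f q" using \<open>?P j f\<close> by auto
    from ex_aged_at_Suc[OF True this] show ?thesis unfolding less_Suc_eq_le by blast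
  next
    case False
    then show ?thesis by (auto simp: Suc_ile_eq)
  qed
  then have "\<exists>e. \<forall>j. ?P j (e j) \<and> ?Q j (e j) (e (Suc j))"
    by (intro dependent_nat_choice) simp_all
  then obtain e where "\<forall>j. ?P j (e j) \<and> ?Q j (e j) (e (Suc j))" ..
  then have e: "?P j (e j)" "length t < j \<Longrightarrow> e (Suc j) t = e j t" for j t
    by simp_all
  \<comment> \<open>The value at \<open>t\<close> no longer changes from stage
    \<open>Suc (length t)\<close> on, because stage \<open>j\<close> is final only on lengths below
    \<open>j\<close>.\<close>
  let ?g = "\<lambda>t. e (Suc (length t)) t"
  have stable: "e j t = ?g t" if "length t < j" for j t
    using that
  proof (induction j)
    case (Suc j)
    then show ?case using e(2)[of t j] by (cases "length t = j") auto
  qed simp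
  have "aged_at ?g q" if q: "enat q < esize A" for q
  proof (rule aged_at_cong[OF q])
    show "aged_at (e (Suc q)) q" using e(1)[of "Suc q"] q by (simp add: Suc_ile_eq)
    show "e (Suc q) t = ?g t" if "length t \<le> q" for t using that by (intro stable) simp
  qed
  then show ?thesis using AEmb_iff by blast
qed

lemma AEmb_extend:
  assumes m: "1 \<le> m" "enat m < esize A" and f: "f \<in> AEmb k F \<K> A (enat m) K"
    and h: "level_fun k (enat m) f h"
    and \<gamma>: "age_map k F (succ_map f ` Tlev k m)
      (restr_cls (succ_map f ` Tlev k m) (Cls k F \<K> K (h (m - 1) + 1)))
      (Tlev k n) (Cls k F \<K> K n) \<gamma>"
    and pre: "\<And>s. s \<in> Tlev k m \<Longrightarrow> prefix (succ_map f s) (\<gamma> (succ_map f s))"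
  shows "\<exists>g\<in>AEmb k F \<K> A (enat m + 1) K. (\<forall>t\<in>Tbelow k (enat m). g t = f t) \<and>
    (\<forall>t\<in>Tlev k m. prefix (\<gamma> (succ_map f t)) (g t))"
proof -
  obtain p where p: "m = Suc p" using m(1) by (cases m) auto
  have f': "\<forall>q<m. aged_at f q" using f by (simp add: AEmb_iff)
  \<comment> \<open>The given \<open>h\<close> is pinned down by \<open>f\<close>, so the class
    carried by the domain of \<open>\<gamma>\<close> sits on the very level where
    \<open>succ_map f\<close> takes its values.\<close>
  have hp: "h (m - 1) + 1 = Suc (height f p)"
    using level_fun_height[OF h, of p] p by simp
  have "enat p < esize A" using p by (auto intro: order.strict_trans[OF _ m(2)])
  then have succ: "age_map k F (Tlev k m) (Cls k F \<K> A m) (Tlev k (Suc (height f p)))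
      (Cls k F \<K> K (Suc (height f p))) (succ_map f)"
    unfolding p using f' p by (intro age_map_succ_map) (auto simp: aged_at_def)
  let ?X = "succ_map f ` Tlev k m"
  have \<sigma>: "age_map k F (Tlev k m) (Cls k F \<K> A m) (Tlev k n) (Cls k F \<K> K n) (\<gamma> \<circ> succ_map f)"
  proof (rule age_mapI)
    have \<gamma>1: "\<gamma> \<in> ?X \<rightarrow> Tlev k n" and \<gamma>2: "inj_on \<gamma> ?X" using \<gamma> by (auto simp: age_map_def)
    show im: "\<gamma> \<circ> succ_map f \<in> Tlev k m \<rightarrow> Tlev k n" using \<gamma>1 by auto
    show "inj_on (\<gamma> \<circ> succ_map f) (Tlev k m)"
      using age_mapD(2)[OF succ] \<gamma>2 by (rule comp_inj_on)
    fix B :: "nat lstr" and \<phi> assume B: "lstruct k F B" "finite (carr B)" "\<phi> \<in> carr B \<rightarrow> Tlev k m"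
    have s: "succ_map f \<circ> \<phi> \<in> carr B \<rightarrow> Tlev k (Suc (height f p))"
      using B(3) age_mapD(1)[OF succ] by auto
    have "(B, succ_map f \<circ> \<phi>) \<in> labeled_strs k F ?X" using B by (auto simp: labeled_strs_def)
    then have "(B, succ_map f \<circ> \<phi>) \<in> restr_cls ?X (Cls k F \<K> K (Suc (height f p))) \<longleftrightarrow>
        (B, \<gamma> \<circ> (succ_map f \<circ> \<phi>)) \<in> Cls k F \<K> K n"
      using \<gamma> unfolding age_map_def hp by blast
    \<comment> \<open>Labels of the form \<open>succ_map f (\<phi> b)\<close> lie in
      \<open>?X\<close>, so for them the restricted class imposes the same condition as the full
      one.\<close>
    moreover have "(B, succ_map f \<circ> \<phi>) \<in> restr_cls ?X (Cls k F \<K> K (Suc (height f p))) \<longleftrightarrow>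
        in_class (bracket F B (succ_map f \<circ> \<phi>) K (Suc (height f p))) \<K>"
      using B s by (auto simp: restr_cls_def Cls_def labeled_strs_def)
    moreover have "\<gamma> \<circ> succ_map f \<circ> \<phi> \<in> carr B \<rightarrow> Tlev k n" using im B(3) by auto
    then have "(B, \<gamma> \<circ> (succ_map f \<circ> \<phi>)) \<in> Cls k F \<K> K n \<longleftrightarrow>
        in_class (bracket F B (\<gamma> \<circ> succ_map f \<circ> \<phi>) K n) \<K>"
      using B by (auto simp: Cls_def labeled_strs_def comp_assoc)
    ultimately show "in_class (bracket F B \<phi> A m) \<K> \<longleftrightarrow>
        in_class (bracket F B (\<gamma> \<circ> succ_map f \<circ> \<phi>) K n) \<K>"
      using age_mapD(3)[OF succ B] by blast
  qed
  have "\<forall>s i. s @ [i] \<in> Tlev k m \<longrightarrow> prefix (f s @ [i]) ((\<gamma> \<circ> succ_map f) (s @ [i]))"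
    using pre by (force simp: succ_map_def)
  from aged_at_extend[OF m(2) f' \<sigma> this]
  obtain g where g: "\<forall>q\<le>m. aged_at g q" "\<forall>t. length t < m \<longrightarrow> g t = f t"
    "\<forall>t\<in>Tlev k m. prefix ((\<gamma> \<circ> succ_map f) t) (g t)"
    by blast
  have "enat m + 1 = enat (Suc m)" by (simp add: one_enat_def)
  then have "g \<in> AEmb k F \<K> A (enat m + 1) K" using g(1) by (simp add: AEmb_iff)
  with g(2,3) show ?thesis by (auto simp: Tbelow_def)
qed

end

theorem theorem2p8:
  fixes k :: nat and F :: "nat \<Rightarrow> nat" and \<K> :: "nat lstr set" and K A :: "nat lstr"
  assumes "is_flip k F"
    and "fraisse_class k F \<K>"
    and "free_amalgamation \<K>"
    and "fraisse_limit k F \<K> K"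
    and "left_dense \<K> K"
    and "enumerated k F A"
    and "age k F A \<subseteq> \<K>"
  shows "(\<forall>(m::nat) f h \<gamma> (n::nat).
            1 \<le> m \<and> enat m < esize A \<and>
            f \<in> AEmb k F \<K> A (enat m) K \<and> level_fun k (enat m) f h \<and>
            age_map k F
              (succ_map f ` Tlev k m)
              (restr_cls (succ_map f ` Tlev k m) (Cls k F \<K> K (h (m - 1) + 1)))
              (Tlev k n) (Cls k F \<K> K n) \<gamma> \<and>
            (\<forall>s\<in>Tlev k m. prefix (succ_map f s) (\<gamma> (succ_map f s)))
          \<longrightarrow> (\<exists>g\<in>AEmb k F \<K> A (enat m + 1) K.
                 (\<forall>t\<in>Tbelow k (enat m). g t = f t) \<and>
                 (\<forall>t\<in>Tlev k m. prefix (\<gamma> (succ_map f t)) (g t))))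
         \<and> AEmb k F \<K> A (esize A) K \<noteq> {}"
proof -
  interpret coding_setting k F \<K> K A
    using assms by unfold_locales
  show ?thesis
    using AEmb_extend AEmb_nonempty by blast
qed

end
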